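(* Let $\alpha_0,\beta_0,\sigma_0,\rho_0>0$, $0<s<1/2$, $0<p,q<1$ and $8p+8q\le s$, and for $k\ge1$ let $$\alpha_k=\alpha_0k^{-s},\quad \beta_k=\beta_0k^{-2p-q},\quad \sigma_k=\sigma_0k^{-q},\quad \rho_k=\rho_0k^{p}.$$ Suppose that $\phi$ is bounded below on $X$. If $\beta_0/\sigma_0$ is sufficiently small (i.e., smaller than some positive constant depending only on the problem data $X,Y,F,f$ and on $\alpha_0,\sigma_0,\rho_0,s,p,q$), then every sequence $\{(x^k,y^k,z^k)\}$ generated by the algorithm SiPBA with these parameters satisfies, as $K\to\infty$, $$\min_{0<k<K}\frac{1}{\alpha_k^2}\|x^{k+1}-x^k\|^2=\mathcal{O}(1/K^{1-2s}),\qquad \min_{0<k<K}\|u^k-u_k^*(x^k)\|^2=\mathcal{O}(1/K^{1-6p-7q}).$$ Moreover, $$\liminf_{k\to\infty}\ \big\|x^k-\mathrm{Proj}_X\big(x^k-\alpha_k\nabla\phi_k(x^k)\big)\big\|/\alpha_k=0\quad\text{and}\quad \liminf_{k\to\infty}\ \|u^k-u_k^*(x^k)\|=0.$$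
   Context: Setting: $X\subseteq\mathbb{R}^n$ and $Y\subseteq\mathbb{R}^m$ are closed convex sets, $X$ is compact, $F,f:\mathbb{R}^n\times\mathbb{R}^m\to\mathbb{R}$, $\mathcal{S}(x):=\arg\min_{y'\in Y}f(x,y')$, and $\phi(x):=\max\{F(x,y):y\in\mathcal{S}(x)\}$. Standing assumptions: (1) $F$ is continuously differentiable, $\nabla F$ is Lipschitz continuous on $X\times Y$, and for some $\mu>0$, for every fixed $x\in X$, $F(x,\cdot)$ is $\mu$-strongly concave on $Y$. (2) $f$ is continuously differentiable, $\nabla f$ is Lipschitz continuous on $X\times Y$, and for every fixed $x\in X$, $f(x,\cdot)$ is convex on $Y$; $\mathcal{S}(x)\neq\varnothing$ for all $x\in X$; and for any bounded set $B\subseteq X$ there is a bounded set $D$ such that $\mathcal{S}(x)\cap D\ne\varnothing$ for every $x\in B$. Notation: for each $k$ and $x\in X$, $$\psi_k(x,y,z):=F(x,y)-\rho_k(f(x,y)-f(x,z))+\frac{\sigma_k}{2}\|z\|^2-\sigma_k\langle y,z\rangle,\qquad \phi_k(x):=\min_{z\in Y}\max_{y\in Y}\psi_k(x,y,z),$$ and $u_k^*(x)=(y_k^*(x),z_k^*(x))\in Y\times Y$ is the unique saddle point of this minimax problem ($\psi_k(x,y,z_k^*(x))\le\psi_k(x,y_k^*(x),z_k^*(x))\le\psi_k(x,y_k^*(x),z)$ for all $y,z\in Y$). The gradient of $\phi_k$ at $x\in X$ is $\nabla\phi_k(x)=\nabla_xF(x,y_k^*(x))-\rho_k\nabla_xf(x,y_k^*(x))+\rho_k\nabla_xf(x,z_k^*(x))$.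 Write $u^k=(y^k,z^k)$. Algorithm SiPBA: from an initial point $(x^0,y^0,z^0)\in X\times Y\times Y$ and parameters $\alpha_k,\beta_k,\rho_k,\sigma_k>0$, for $k=0,1,2,\dots$ set $$d_y^k=\nabla_yF(x^k,y^k)-\rho_k\nabla_yf(x^k,y^k)-\sigma_kz^k,\quad d_z^k=\rho_k\nabla_yf(x^k,z^k)+\sigma_k(z^k-y^k),$$ $$y^{k+1}=\mathrm{Proj}_Y(y^k+\beta_kd_y^k),\quad z^{k+1}=\mathrm{Proj}_Y(z^k-\beta_kd_z^k),$$ $$d_x^k=\nabla_xF(x^k,y^{k+1})-\rho_k\big(\nabla_xf(x^k,y^{k+1})-\nabla_xf(x^k,z^{k+1})\big),\quad x^{k+1}=\mathrm{Proj}_X(x^k-\alpha_kd_x^k),$$ where $\mathrm{Proj}$ is Euclidean projection. At $k=0$ the parameters are the constants $\alpha_0,\beta_0,\rho_0,\sigma_0$. *)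

theory Defs
  imports "HOL-Analysis.Analysis" "HOL-Library.Landau_Symbols"
begin

definition grad :: "('a::real_inner \<Rightarrow> real) \<Rightarrow> 'a \<Rightarrow> 'a" where
  "grad g a = (THE D. GDERIV g a :> D)"

definition grad_x :: "('a::real_inner \<times> 'b::real_inner \<Rightarrow> real) \<Rightarrow> 'a \<Rightarrow> 'b \<Rightarrow> 'a" where
  "grad_x g x y = grad (\<lambda>x'. g (x', y)) x"

definition grad_y :: "('a::real_inner \<times> 'b::real_inner \<Rightarrow> real) \<Rightarrow> 'a \<Rightarrow> 'b \<Rightarrow> 'b" where
  "grad_y g x y = grad (\<lambda>y'. g (x, y')) y"

definition continuously_differentiable :: "('a::real_inner \<Rightarrow> real) \<Rightarrow> bool" where
  "continuously_differentiable g \<longleftrightarrow>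
     (\<forall>a. g differentiable (at a)) \<and> continuous_on UNIV (grad g)"

definition lipschitz_grad_on :: "'a::real_inner set \<Rightarrow> ('a \<Rightarrow> real) \<Rightarrow> bool" where
  "lipschitz_grad_on U g \<longleftrightarrow> (\<exists>L. lipschitz_on L U (grad g))"

definition strongly_concave_on :: "real \<Rightarrow> 'a::real_inner set \<Rightarrow> ('a \<Rightarrow> real) \<Rightarrow> bool" where
  "strongly_concave_on \<mu> U g \<longleftrightarrow>
     (\<forall>a\<in>U. \<forall>b\<in>U. \<forall>t\<in>{0..1}.
        g ((1 - t) *\<^sub>R a + t *\<^sub>R b)
          \<ge> (1 - t) * g a + t * g b + \<mu> / 2 * t * (1 - t) * (norm (a - b))\<^sup>2)"

definition argmin_set :: "'b set \<Rightarrow> ('a \<times> 'b \<Rightarrow> real) \<Rightarrow> 'a \<Rightarrow> 'b set" where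
  "argmin_set Y f x = {y. is_arg_min (\<lambda>y'. f (x, y')) (\<lambda>y'. y' \<in> Y) y}"

text \<open>The pessimistic value function \<open>\<phi>\<close>; the maximum is attained whenever the
  solution set is closed, convex and nonempty and \<open>F (x, \<cdot>)\<close> is continuous and strongly concave.\<close>

definition phi :: "'b set \<Rightarrow> ('a \<times> 'b \<Rightarrow> real) \<Rightarrow> ('a \<times> 'b \<Rightarrow> real) \<Rightarrow> 'a \<Rightarrow> real" where
  "phi Y F f x = (GREATEST v. v \<in> (\<lambda>y. F (x, y)) ` argmin_set Y f x)"

definition psi :: "('a \<times> 'b::real_inner \<Rightarrow> real) \<Rightarrow> ('a \<times> 'b \<Rightarrow> real) \<Rightarrow> real \<Rightarrow> real
    \<Rightarrow> 'a \<Rightarrow> 'b \<Rightarrow> 'b \<Rightarrow> real" where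
  "psi F f \<rho> \<sigma> x y z =
     F (x, y) - \<rho> * (f (x, y) - f (x, z)) + \<sigma> / 2 * (norm z)\<^sup>2 - \<sigma> * inner y z"

definition is_saddle_point :: "'b set \<Rightarrow> ('b \<Rightarrow> 'b \<Rightarrow> real) \<Rightarrow> 'b \<times> 'b \<Rightarrow> bool" where
  "is_saddle_point Y h u \<longleftrightarrow> fst u \<in> Y \<and> snd u \<in> Y \<and>
     (\<forall>y\<in>Y. \<forall>z\<in>Y. h y (snd u) \<le> h (fst u) (snd u) \<and> h (fst u) (snd u) \<le> h (fst u) z)"

definition ustar :: "'b::real_inner set \<Rightarrow> ('a \<times> 'b \<Rightarrow> real) \<Rightarrow> ('a \<times> 'b \<Rightarrow> real)
    \<Rightarrow> real \<Rightarrow> real \<Rightarrow> 'a \<Rightarrow> 'b \<times> 'b" where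
  "ustar Y F f \<rho> \<sigma> x = (THE u. is_saddle_point Y (psi F f \<rho> \<sigma> x) u)"

text \<open>The gradient of \<open>x \<mapsto> min\<^sub>z max\<^sub>y psi F f \<rho> \<sigma> x y z\<close> is given by the Danskin formula at the
  saddle point. That minimax value is controlled only for \<open>x \<in> X\<close>, and \<open>X\<close> may have empty interior,
  so the formula itself, rather than a limit in the ambient space, fixes the vector.\<close>

definition grad_phi :: "'b::real_inner set \<Rightarrow> ('a::real_inner \<times> 'b \<Rightarrow> real) \<Rightarrow> ('a \<times> 'b \<Rightarrow> real)
    \<Rightarrow> real \<Rightarrow> real \<Rightarrow> 'a \<Rightarrow> 'a" where
  "grad_phi Y F f \<rho> \<sigma> x =
     (let (ys, zs) = ustar Y F f \<rho> \<sigma> x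
      in grad_x F x ys - \<rho> *\<^sub>R grad_x f x ys + \<rho> *\<^sub>R grad_x f x zs)"

definition dir_y :: "('a::real_inner \<times> 'b::real_inner \<Rightarrow> real) \<Rightarrow> ('a \<times> 'b \<Rightarrow> real)
    \<Rightarrow> real \<Rightarrow> real \<Rightarrow> 'a \<Rightarrow> 'b \<Rightarrow> 'b \<Rightarrow> 'b" where
  "dir_y F f \<rho> \<sigma> x y z = grad_y F x y - \<rho> *\<^sub>R grad_y f x y - \<sigma> *\<^sub>R z"

definition dir_z :: "('a::real_inner \<times> 'b::real_inner \<Rightarrow> real)
    \<Rightarrow> real \<Rightarrow> real \<Rightarrow> 'a \<Rightarrow> 'b \<Rightarrow> 'b \<Rightarrow> 'b" where
  "dir_z f \<rho> \<sigma> x y z = \<rho> *\<^sub>R grad_y f x z + \<sigma> *\<^sub>R (z - y)"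

definition dir_x :: "('a::real_inner \<times> 'b::real_inner \<Rightarrow> real) \<Rightarrow> ('a \<times> 'b \<Rightarrow> real)
    \<Rightarrow> real \<Rightarrow> 'a \<Rightarrow> 'b \<Rightarrow> 'b \<Rightarrow> 'a" where
  "dir_x F f \<rho> x y z = grad_x F x y - \<rho> *\<^sub>R (grad_x f x y - grad_x f x z)"

definition SiPBA :: "'a::euclidean_space set \<Rightarrow> 'b::euclidean_space set
    \<Rightarrow> ('a \<times> 'b \<Rightarrow> real) \<Rightarrow> ('a \<times> 'b \<Rightarrow> real)
    \<Rightarrow> (nat \<Rightarrow> real) \<Rightarrow> (nat \<Rightarrow> real) \<Rightarrow> (nat \<Rightarrow> real) \<Rightarrow> (nat \<Rightarrow> real)
    \<Rightarrow> (nat \<Rightarrow> 'a) \<Rightarrow> (nat \<Rightarrow> 'b) \<Rightarrow> (nat \<Rightarrow> 'b) \<Rightarrow> bool" where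
  "SiPBA X Y F f \<alpha> \<beta> \<rho> \<sigma> x y z \<longleftrightarrow>
     x 0 \<in> X \<and> y 0 \<in> Y \<and> z 0 \<in> Y \<and>
     (\<forall>k. y (Suc k) = closest_point Y (y k + \<beta> k *\<^sub>R dir_y F f (\<rho> k) (\<sigma> k) (x k) (y k) (z k)) \<and>
          z (Suc k) = closest_point Y (z k - \<beta> k *\<^sub>R dir_z f (\<rho> k) (\<sigma> k) (x k) (y k) (z k)) \<and>
          x (Suc k) = closest_point X (x k - \<alpha> k *\<^sub>R dir_x F f (\<rho> k) (x k) (y (Suc k)) (z (Suc k))))"

definition power_schedule :: "real \<Rightarrow> real \<Rightarrow> nat \<Rightarrow> real" where
  "power_schedule c e k = (if k = 0 then c else c * real k powr e)"

end

theory Submission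
  imports Defs
begin

text \<open>For \<open>x \<in> X\<close> the saddle point \<open>u\<^sub>k*(x)\<close> solves a variational inequality on \<open>Y \<times> Y\<close> for an
  operator that is strongly monotone with modulus \<open>min \<mu> \<sigma>\<^sub>k\<close> and Lipschitz with constant \<open>O(\<rho>\<^sub>k)\<close>.
  If \<open>\<beta>\<^sub>0 / \<sigma>\<^sub>0\<close> is small, the inner step therefore contracts the squared distance to \<open>u\<^sub>k*\<close> by the
  factor \<open>1 - \<beta>\<^sub>k \<sigma>\<^sub>k\<close>, and \<open>u\<^sub>k*\<close> is Lipschitz in \<open>x\<close> with constant \<open>O(\<rho>\<^sub>k / \<sigma>\<^sub>k)\<close>. The saddle value
  \<open>\<phi>\<^sub>k\<close> satisfies a descent inequality on \<open>X\<close>, is bounded below uniformly in \<open>k\<close>, and grows by at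
  most \<open>O(k\<^bsup>-1-q\<^esup>)\<close> from \<open>k\<close> to \<open>k + 1\<close>. Since \<open>8 p + 8 q \<le> s\<close>, the Lyapunov function
  \<open>\<phi>\<^sub>k(x\<^sup>k) + \<parallel>u\<^sup>k - u\<^sub>k*(x\<^sup>k)\<parallel>\<^sup>2\<close> eventually decreases up to a summable error, so
  \<open>\<parallel>x\<^bsup>k+1\<^esup> - x\<^sup>k\<parallel>\<^sup>2 / \<alpha>\<^sub>k + \<beta>\<^sub>k \<sigma>\<^sub>k \<parallel>u\<^sup>k - u\<^sub>k*(x\<^sup>k)\<parallel>\<^sup>2\<close> is summable. The rates and the limits
  inferior follow because the weights \<open>\<alpha>\<^sub>k\<close> and \<open>\<beta>\<^sub>k \<sigma>\<^sub>k\<close> are powers of \<open>k\<close> with divergent sum.\<close>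

subsection \<open>Gradients\<close>

lemma grad_eqI:
  assumes "(g has_derivative (\<lambda>h. h \<bullet> D)) (at a)"
  shows "grad g a = D"
  unfolding grad_def
proof (rule the_equality)
  show "GDERIV g a :> D" using assms by (simp add: gderiv_def)
next
  fix D' assume "GDERIV g a :> D'"
  then have "(g has_derivative (\<lambda>h. h \<bullet> D')) (at a)" by (simp add: gderiv_def)
  then have "(\<lambda>h. h \<bullet> D') = (\<lambda>h. h \<bullet> D)"
    using assms has_derivative_unique by blast
  then show "D' = D" by (metis inner_commute vector_eq_rdot)
qed

text \<open>The values of the derivative on \<open>Basis\<close> are the coordinates of its Riesz
  representative. This gives the description \<open>grad\<close>, which by itself asserts nothing,
  an existing vector to denote.\<close>

lemma has_derivative_grad:
  fixes g :: "'a::euclidean_space \<Rightarrow> real"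
  assumes "g differentiable (at a)"
  shows "(g has_derivative (\<lambda>h. h \<bullet> grad g a)) (at a)"
proof -
  obtain g' where g': "(g has_derivative g') (at a)"
    using assms by (auto simp: differentiable_def)
  interpret bounded_linear g' using g' by (rule has_derivative_bounded_linear)
  let ?D = "\<Sum>b\<in>Basis. g' b *\<^sub>R b"
  have "g' h = h \<bullet> ?D" for h
  proof -
    have "g' h = g' (\<Sum>b\<in>Basis. (h \<bullet> b) *\<^sub>R b)" by (simp add: euclidean_representation)
    also have "\<dots> = h \<bullet> ?D"
      by (simp add: sum scaleR inner_sum_right mult.commute)
    finally show ?thesis .
  qed
  then have "(g has_derivative (\<lambda>h. h \<bullet> ?D)) (at a)"
    using g' by (metis (no_types, lifting) ext)
  then show ?thesis using grad_eqI by metis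
qed

text \<open>Chain rule along the affine embeddings of the two factors. Partial gradients thereby
  become components of \<open>grad g\<close> and inherit its Lipschitz bound.\<close>

lemma grad_partial:
  fixes g :: "'a::euclidean_space \<times> 'b::euclidean_space \<Rightarrow> real"
  assumes "g differentiable (at (x, y))"
  shows has_derivative_grad_x: "((\<lambda>x'. g (x', y)) has_derivative (\<lambda>h. h \<bullet> grad_x g x y)) (at x)"
    and has_derivative_grad_y: "((\<lambda>y'. g (x, y')) has_derivative (\<lambda>h. h \<bullet> grad_y g x y)) (at y)"
    and grad_x_eq: "grad_x g x y = fst (grad g (x, y))"
    and grad_y_eq: "grad_y g x y = snd (grad g (x, y))"
proof -
  note g = has_derivative_grad[OF assms]
  have "((\<lambda>x'. g (x', y)) has_derivative (\<lambda>h. (h, 0) \<bullet> grad g (x, y))) (at x)"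
    by (rule has_derivative_compose[where f = "\<lambda>x'. (x', y)"])
      (use g in \<open>auto intro!: derivative_eq_intros\<close>)
  then have 1: "((\<lambda>x'. g (x', y)) has_derivative (\<lambda>h. h \<bullet> fst (grad g (x, y)))) (at x)"
    by (simp add: inner_prod_def)
  have "((\<lambda>y'. g (x, y')) has_derivative (\<lambda>h. (0, h) \<bullet> grad g (x, y))) (at y)"
    by (rule has_derivative_compose[where f = "\<lambda>y'. (x, y')"])
      (use g in \<open>auto intro!: derivative_eq_intros\<close>)
  then have 2: "((\<lambda>y'. g (x, y')) has_derivative (\<lambda>h. h \<bullet> snd (grad g (x, y)))) (at y)"
    by (simp add: inner_prod_def)
  show 3: "grad_x g x y = fst (grad g (x, y))" unfolding grad_x_def by (rule grad_eqI[OF 1])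
  show 4: "grad_y g x y = snd (grad g (x, y))" unfolding grad_y_def by (rule grad_eqI[OF 2])
  from 1 3 show "((\<lambda>x'. g (x', y)) has_derivative (\<lambda>h. h \<bullet> grad_x g x y)) (at x)" by simp
  from 2 4 show "((\<lambda>y'. g (x, y')) has_derivative (\<lambda>h. h \<bullet> grad_y g x y)) (at y)" by simp
qed

text \<open>At a mean value point of the segment, which stays in \<open>C\<close> by convexity, the
  gradient has moved by at most \<open>L * norm (v - u)\<close>. Using a single point instead of an
  integral loses the usual factor 1/2, which only affects constants.\<close>

lemma lipschitz_grad_quadratic_bound:
  fixes g :: "'a::euclidean_space \<Rightarrow> real"
  assumes diff: "\<And>a. g differentiable (at a)" and lip: "L-lipschitz_on C (grad g)"
    and C: "convex C" "u \<in> C" "v \<in> C"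
  shows "\<bar>g v - g u - grad g u \<bullet> (v - u)\<bar> \<le> L * (norm (v - u))\<^sup>2"
proof -
  let ?h = "\<lambda>t::real. u + t *\<^sub>R (v - u)"
  have "((\<lambda>t. g (?h t)) has_derivative (\<lambda>t. (t *\<^sub>R (v - u)) \<bullet> grad g (?h t0))) (at t0 within {0..1})"
    for t0
    by (rule has_derivative_compose[OF _ has_derivative_grad[OF diff]])
      (auto intro!: derivative_eq_intros)
  from mvt_very_simple[OF zero_le_one this]
  obtain t where t: "t \<in> {0..1}" and eq: "g v - g u = (v - u) \<bullet> grad g (?h t)"
    by auto
  have "?h t = (1 - t) *\<^sub>R u + t *\<^sub>R v" by (simp add: algebra_simps)
  then have mem: "?h t \<in> C" using C t by (simp add: convexD_alt)
  have "g v - g u - grad g u \<bullet> (v - u) = (grad g (?h t) - grad g u) \<bullet> (v - u)"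
    by (simp add: eq inner_diff_left inner_diff_right inner_commute)
  then have "\<bar>g v - g u - grad g u \<bullet> (v - u)\<bar> \<le> norm (grad g (?h t) - grad g u) * norm (v - u)"
    using Cauchy_Schwarz_ineq2 by metis
  also have "norm (grad g (?h t) - grad g u) \<le> L * (t * norm (v - u))"
    using lipschitz_onD[OF lip mem C(2)] t by (simp add: dist_norm)
  also have "L * (t * norm (v - u)) \<le> L * (1 * norm (v - u))"
    using t lipschitz_on_nonneg[OF lip] by (intro mult_left_mono mult_right_mono) auto
  finally show ?thesis by (simp add: power2_eq_square mult_right_mono mult.assoc)
qed

text \<open>The strong concavity inequality along the segment is divided by \<open>t\<close>, and
  \<open>t\<close> tends to 0 from the right. Only points of the segment are tested, so
  \<open>a\<close> may be a boundary point of \<open>U\<close>.\<close>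

lemma strongly_concave_first_order:
  fixes h :: "'a::real_inner \<Rightarrow> real"
  assumes conc: "strongly_concave_on \<mu> U h" and U: "a \<in> U" "b \<in> U"
    and der: "(h has_derivative (\<lambda>v. v \<bullet> D)) (at a)"
  shows "h b \<le> h a + (b - a) \<bullet> D - \<mu> / 2 * (norm (b - a))\<^sup>2"
proof -
  let ?k = "\<lambda>t::real. h (a + t *\<^sub>R (b - a))"
  have "(?k has_derivative (\<lambda>t. (t *\<^sub>R (b - a)) \<bullet> D)) (at 0)"
    by (rule has_derivative_compose[of "\<lambda>t. a + t *\<^sub>R (b - a)" _ 0])
      (use der in \<open>auto intro!: derivative_eq_intros\<close>)
  moreover have "(\<lambda>t. (t *\<^sub>R (b - a)) \<bullet> D) = (*) ((b - a) \<bullet> D)" by (auto simp: mult.commute)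
  ultimately have "(?k has_real_derivative ((b - a) \<bullet> D)) (at 0)"
    by (simp only: has_field_derivative_def)
  then have "((\<lambda>t. (?k t - ?k 0) / t) \<longlongrightarrow> (b - a) \<bullet> D) (at_right 0)"
    unfolding DERIV_def by (auto intro: tendsto_within_subset)
  moreover have "((\<lambda>t. h b - h a + \<mu> / 2 * (1 - t) * (norm (b - a))\<^sup>2)
      \<longlongrightarrow> h b - h a + \<mu> / 2 * (1 - 0) * (norm (b - a))\<^sup>2) (at_right 0)"
    by (intro tendsto_intros)
  moreover have "\<forall>\<^sub>F t in at_right 0.
      h b - h a + \<mu> / 2 * (1 - t) * (norm (b - a))\<^sup>2 \<le> (?k t - ?k 0) / t"
  proof -
    have "h b - h a + \<mu> / 2 * (1 - t) * (norm (b - a))\<^sup>2 \<le> (?k t - ?k 0) / t"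
      if "0 < t" "t < 1" for t
    proof -
      have "h ((1 - t) *\<^sub>R a + t *\<^sub>R b)
          \<ge> (1 - t) * h a + t * h b + \<mu> / 2 * t * (1 - t) * (norm (a - b))\<^sup>2"
        using conc U that unfolding strongly_concave_on_def by simp
      moreover have "(1 - t) *\<^sub>R a + t *\<^sub>R b = a + t *\<^sub>R (b - a)" by (simp add: algebra_simps)
      ultimately show ?thesis using that
        by (simp add: field_simps norm_minus_commute)
    qed
    then show ?thesis
      by (intro eventually_at_rightI[of 0 1]) auto
  qed
  ultimately have "h b - h a + \<mu> / 2 * (1 - 0) * (norm (b - a))\<^sup>2 \<le> (b - a) \<bullet> D"
    by (rule tendsto_le[OF trivial_limit_at_right_real])
  then show ?thesis by simp
qed

text \<open>With modulus 0, the first-order inequality for concave functions also serves for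
  \<open>f\<close>.\<close>

lemma convex_on_imp_strongly_concave_on_uminus:
  assumes "convex_on U h"
  shows "strongly_concave_on 0 U (\<lambda>y. - h y)"
  unfolding strongly_concave_on_def
proof (intro ballI)
  fix a b and t :: real assume "a \<in> U" "b \<in> U" "t \<in> {0..1}"
  then show "(1 - t) * - h a + t * - h b + 0 / 2 * t * (1 - t) * (norm (a - b))\<^sup>2
      \<le> - h ((1 - t) *\<^sub>R a + t *\<^sub>R b)"
    using convex_onD[OF assms, of t a b] by simp
qed

subsection \<open>Strongly monotone variational inequalities\<close>

text \<open>Squared distances add over the factors. The two projections of the inner step thus form
  one projection onto \<open>Y \<times> Y\<close>.\<close>

lemma closest_point_Times:
  fixes A :: "'a::euclidean_space set" and B :: "'b::euclidean_space set"
  assumes A: "convex A" "closed A" "A \<noteq> {}" and B: "convex B" "closed B" "B \<noteq> {}"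
  shows "closest_point (A \<times> B) (a, b) = (closest_point A a, closest_point B b)"
proof (rule sym, rule closest_point_unique)
  show "convex (A \<times> B)" "closed (A \<times> B)" using A B by (auto intro: convex_Times closed_Times)
  show "(closest_point A a, closest_point B b) \<in> A \<times> B"
    using A B by (simp add: closest_point_in_set)
  show "\<forall>w\<in>A \<times> B. dist (a, b) (closest_point A a, closest_point B b) \<le> dist (a, b) w"
    using A B by (auto simp: dist_Pair_Pair intro!: power_mono closest_point_le real_sqrt_le_mono add_mono)
qed

text \<open>Projection is nonexpansive, so the square is expanded before projecting. The term
  quadratic in \<open>\<gamma>\<close> is absorbed by half of the gain from monotonicity.\<close>

lemma projected_step_contraction:
  fixes D :: "'a::euclidean_space \<Rightarrow> 'a"
  assumes C: "convex C" "closed C" "C \<noteq> {}"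
    and mono: "m * (norm (u - v))\<^sup>2 \<le> (D u - D v) \<bullet> (u - v)"
    and lip: "norm (D u - D v) \<le> \<Lambda> * norm (u - v)"
    and \<gamma>: "0 \<le> \<gamma>" "\<gamma> * \<Lambda>\<^sup>2 \<le> m"
  shows "(norm (closest_point C (u - \<gamma> *\<^sub>R D u) - closest_point C (v - \<gamma> *\<^sub>R D v)))\<^sup>2
     \<le> (1 - \<gamma> * m) * (norm (u - v))\<^sup>2"
proof -
  have "(norm (closest_point C (u - \<gamma> *\<^sub>R D u) - closest_point C (v - \<gamma> *\<^sub>R D v)))\<^sup>2
      \<le> (norm ((u - v) - \<gamma> *\<^sub>R (D u - D v)))\<^sup>2"
    using closest_point_lipschitz[OF C, of "u - \<gamma> *\<^sub>R D u" "v - \<gamma> *\<^sub>R D v"]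
    by (intro power_mono) (auto simp: dist_norm algebra_simps)
  also have "\<dots> = (norm (u - v))\<^sup>2 - 2 * \<gamma> * ((D u - D v) \<bullet> (u - v)) + \<gamma>\<^sup>2 * (norm (D u - D v))\<^sup>2"
    unfolding power2_norm_eq_inner
    by (simp add: inner_diff_left inner_diff_right inner_commute power2_eq_square algebra_simps)
  also have "(norm (D u - D v))\<^sup>2 \<le> (\<Lambda> * norm (u - v))\<^sup>2"
    using lip by (intro power_mono) auto
  also have "\<gamma>\<^sup>2 * (\<Lambda> * norm (u - v))\<^sup>2 = \<gamma> * ((\<gamma> * \<Lambda>\<^sup>2) * (norm (u - v))\<^sup>2)"
    by (simp add: power2_eq_square)
  also have "\<dots> \<le> \<gamma> * (m * (norm (u - v))\<^sup>2)"
    using \<gamma> by (intro mult_left_mono mult_right_mono) auto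
  finally have "(norm (closest_point C (u - \<gamma> *\<^sub>R D u) - closest_point C (v - \<gamma> *\<^sub>R D v)))\<^sup>2
      \<le> (norm (u - v))\<^sup>2 - 2 * \<gamma> * ((D u - D v) \<bullet> (u - v)) + \<gamma> * (m * (norm (u - v))\<^sup>2)"
    by (simp add: mult_left_mono)
  moreover have "\<gamma> * (m * (norm (u - v))\<^sup>2) \<le> \<gamma> * ((D u - D v) \<bullet> (u - v))"
    using mono \<gamma> by (intro mult_left_mono) auto
  ultimately show ?thesis by (simp add: algebra_simps)
qed

text \<open>Obtuse angle characterisation of the projection: rest points of the projected step do
  not depend on the step size.\<close>

lemma closest_point_fixpoint_iff_variational:
  fixes C :: "'a::euclidean_space set"
  assumes C: "convex C" "closed C" and u: "u \<in> C" and \<gamma>: "0 < \<gamma>"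
  shows "closest_point C (u - \<gamma> *\<^sub>R d) = u \<longleftrightarrow> (\<forall>w\<in>C. 0 \<le> d \<bullet> (w - u))"
proof
  assume eq: "closest_point C (u - \<gamma> *\<^sub>R d) = u"
  show "\<forall>w\<in>C. 0 \<le> d \<bullet> (w - u)"
  proof
    fix w assume "w \<in> C"
    from closest_point_dot[OF C this, of "u - \<gamma> *\<^sub>R d"]
    show "0 \<le> d \<bullet> (w - u)" using \<gamma> by (simp add: eq zero_le_mult_iff)
  qed
next
  assume vi: "\<forall>w\<in>C. 0 \<le> d \<bullet> (w - u)"
  have "dist (u - \<gamma> *\<^sub>R d) u \<le> dist (u - \<gamma> *\<^sub>R d) w" if "w \<in> C" for w
  proof -
    have "(norm (u - \<gamma> *\<^sub>R d - w))\<^sup>2 = (norm (\<gamma> *\<^sub>R d))\<^sup>2 + 2 * \<gamma> * (d \<bullet> (w - u)) + (norm (w - u))\<^sup>2"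
      unfolding power2_norm_eq_inner
      by (simp add: inner_diff_left inner_diff_right inner_commute algebra_simps)
    moreover have "0 \<le> 2 * \<gamma> * (d \<bullet> (w - u))" using vi that \<gamma> by simp
    ultimately have "(norm (\<gamma> *\<^sub>R d))\<^sup>2 \<le> (norm (u - \<gamma> *\<^sub>R d - w))\<^sup>2"
      by (smt (verit) zero_le_power2)
    then have "norm (\<gamma> *\<^sub>R d) \<le> norm (u - \<gamma> *\<^sub>R d - w)"
      by (rule power2_le_imp_le) simp
    then show ?thesis by (simp add: dist_norm)
  qed
  then show "closest_point C (u - \<gamma> *\<^sub>R d) = u"
    using closest_point_unique[OF C u, of "u - \<gamma> *\<^sub>R d"] by auto
qed

text \<open>For a small step size the projected step is a contraction of \<open>C\<close>, and its
  fixed point is the solution.\<close>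

lemma strongly_monotone_variational_exists:
  fixes D :: "'a::euclidean_space \<Rightarrow> 'a"
  assumes C: "convex C" "closed C" "C \<noteq> {}" and m: "0 < m"
    and mono: "\<And>u v. u \<in> C \<Longrightarrow> v \<in> C \<Longrightarrow> m * (norm (u - v))\<^sup>2 \<le> (D u - D v) \<bullet> (u - v)"
    and lip: "\<And>u v. u \<in> C \<Longrightarrow> v \<in> C \<Longrightarrow> norm (D u - D v) \<le> \<Lambda> * norm (u - v)"
  shows "\<exists>u\<in>C. \<forall>w\<in>C. 0 \<le> D u \<bullet> (w - u)"
proof -
  \<comment> \<open>The first cap keeps \<open>1 - \<gamma> * m\<close> at least 1/2, so its square
    root is a valid Banach factor. The second gives
    \<open>\<gamma> * \<Lambda>\<^sup>2 \<le> m\<close>; the added 1 avoids division by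
    zero.\<close>
  define \<gamma> where "\<gamma> = min (1 / (2 * m)) (m / (\<Lambda>\<^sup>2 + 1))"
  have pos: "0 < \<Lambda>\<^sup>2 + 1" by (smt (verit) zero_le_power2)
  have \<gamma>: "0 < \<gamma>" "\<gamma> \<le> 1 / (2 * m)" "\<gamma> \<le> m / (\<Lambda>\<^sup>2 + 1)"
    using m pos by (auto simp: \<gamma>_def)
  have \<gamma>m: "\<gamma> * m \<le> 1 / 2" using \<gamma>(2) m by (simp add: field_simps)
  have "\<gamma> * (\<Lambda>\<^sup>2 + 1) \<le> m" using \<gamma>(3) pos by (simp add: field_simps)
  then have \<gamma>\<Lambda>: "\<gamma> * \<Lambda>\<^sup>2 \<le> m" using \<gamma>(1) by (simp add: algebra_simps)
  let ?P = "\<lambda>u. closest_point C (u - \<gamma> *\<^sub>R D u)"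
  have "\<exists>!u\<in>C. ?P u = u"
  proof (rule Banach_fix)
    show "complete C" using C by (simp add: complete_eq_closed)
    show "C \<noteq> {}" by fact
    show "0 \<le> sqrt (1 - \<gamma> * m)" "sqrt (1 - \<gamma> * m) < 1" using \<gamma> m \<gamma>m by auto
    show "?P ` C \<subseteq> C" using C by (auto intro: closest_point_in_set)
    fix u v assume "u \<in> C" "v \<in> C"
    then have "(norm (?P u - ?P v))\<^sup>2 \<le> (1 - \<gamma> * m) * (norm (u - v))\<^sup>2"
      using \<gamma> \<gamma>\<Lambda> by (intro projected_step_contraction[OF C mono lip]) auto
    then have "sqrt ((norm (?P u - ?P v))\<^sup>2) \<le> sqrt ((1 - \<gamma> * m) * (norm (u - v))\<^sup>2)"
      by (rule real_sqrt_le_mono)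
    then show "dist (?P u) (?P v) \<le> sqrt (1 - \<gamma> * m) * dist u v"
      by (simp add: real_sqrt_mult dist_norm)
  qed
  then show ?thesis
    using closest_point_fixpoint_iff_variational[OF C(1,2) _ \<gamma>(1)] by blast
qed

text \<open>Each solution is tested against the other and the inequalities are added. The two
  operators then need to be compared at \<open>v\<close> only.\<close>

lemma strongly_monotone_variational_stability:
  fixes u :: "'a::real_inner"
  assumes mono: "m * (norm (u - v))\<^sup>2 \<le> (D u - D v) \<bullet> (u - v)"
    and u: "0 \<le> D u \<bullet> (v - u)" and v: "0 \<le> D' v \<bullet> (u - v)"
  shows "m * norm (u - v) \<le> norm (D' v - D v)"
proof (cases "u = v")
  case False
  have "D u \<bullet> (u - v) \<le> 0" using u by (simp add: inner_diff_right)
  then have "m * (norm (u - v))\<^sup>2 \<le> (D' v - D v) \<bullet> (u - v)"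
    using mono v by (simp add: inner_diff_left)
  also have "\<dots> \<le> norm (D' v - D v) * norm (u - v)" by (rule norm_cauchy_schwarz)
  finally show ?thesis using False by (simp add: power2_eq_square)
qed simp

subsection \<open>Weighted series\<close>

text \<open>Telescoping from the index after which the hypotheses hold bounds the shifted partial
  sums of \<open>a\<close>.\<close>

lemma summable_from_descent:
  fixes W a \<epsilon> :: "nat \<Rightarrow> real"
  assumes step: "\<forall>\<^sub>F k in sequentially. W (Suc k) \<le> W k - a k + \<epsilon> k"
    and a: "\<And>k. 0 \<le> a k" and \<epsilon>: "summable \<epsilon>" "\<And>k. 0 \<le> \<epsilon> k"
    and bdd: "\<forall>\<^sub>F k in sequentially. B \<le> W k"
  shows "summable a"
proof -
  obtain N where N: "\<And>k. k \<ge> N \<Longrightarrow> W (Suc k) \<le> W k - a k + \<epsilon> k" "\<And>k. k \<ge> N \<Longrightarrow> B \<le> W k"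
    using eventually_conj[OF step bdd] unfolding eventually_sequentially by auto
  have partial: "W (n + N) + (\<Sum>i<n. a (i + N)) \<le> W N + (\<Sum>i<n. \<epsilon> (i + N))" for n
  proof (induction n)
    case (Suc n)
    then show ?case using N(1)[of "n + N"] by simp
  qed simp
  have "summable (\<lambda>i. \<epsilon> (i + N))" using \<epsilon>(1) by (rule summable_ignore_initial_segment)
  then have tail: "(\<Sum>i<n. \<epsilon> (i + N)) \<le> (\<Sum>i. \<epsilon> (i + N))" for n
    using \<epsilon>(2) by (intro sum_le_suminf) auto
  have "(\<Sum>i<n. a (i + N)) \<le> W N + (\<Sum>i. \<epsilon> (i + N)) - B" for n
    using partial[of n] tail[of n] N(2)[OF le_add2, of n] by linarith
  then have "summable (\<lambda>i. a (i + N))"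
    using a by (intro summableI_nonneg_bounded) auto
  then show ?thesis by (simp only: summable_iff_shift)
qed

text \<open>For \<open>0 < k < K\<close> each weight is at least the weight at \<open>K\<close> and
  each term at least the minimum, so the series bounds \<open>K - 1\<close> copies of their product.
  The exponent \<open>r'\<close> leaves room for a weaker rate than the weight gives.\<close>

lemma Min_bigo_of_weighted_summable:
  fixes a :: "nat \<Rightarrow> real"
  assumes a: "\<And>k. 0 \<le> a k" and sum: "summable (\<lambda>k. real k powr (- r) * a k)"
    and r: "0 \<le> r" "r \<le> r'"
  shows "(\<lambda>K. MIN k\<in>{0<..<K}. a k) \<in> O(\<lambda>K. 1 / real K powr (1 - r'))"
\<comment> \<open>From \<open>K = 2\<close> on, the index range is nonempty and
  \<open>K - 1 \<ge> K / 2\<close>; the latter is the source of the factor 2.\<close>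
proof (rule bigoI[of _ "2 * (\<Sum>k. real k powr (- r) * a k)"], rule eventually_sequentiallyI[of 2])
  fix K :: nat assume K: "2 \<le> K"
  let ?S = "\<Sum>k. real k powr (- r) * a k"
  let ?m = "MIN k\<in>{0<..<K}. a k"
  have "1 \<in> {0<..<K}" using K by auto
  then have ne: "a ` {0<..<K} \<noteq> {}" by blast
  have m0: "0 \<le> ?m" using ne a by (auto simp: Min_ge_iff)
  have "(real K - 1) * (real K powr (- r) * ?m) = (\<Sum>k\<in>{0<..<K}. real K powr (- r) * ?m)"
    using K by (simp add: of_nat_diff)
  also have "\<dots> \<le> (\<Sum>k\<in>{0<..<K}. real k powr (- r) * a k)"
    using r m0 by (intro sum_mono mult_mono powr_mono2' Min_le) auto
  also have "\<dots> \<le> ?S" using sum a by (intro sum_le_suminf) auto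
  finally have 1: "(real K - 1) * (real K powr (- r) * ?m) \<le> ?S" .
  have "real K / 2 * (real K powr (- r) * ?m) \<le> (real K - 1) * (real K powr (- r) * ?m)"
    using K m0 by (intro mult_right_mono) auto
  then have 2: "real K * real K powr (- r) * ?m \<le> 2 * ?S" using 1 by (simp add: algebra_simps)
  have "real K powr (1 - r') * ?m \<le> real K powr (1 - r) * ?m"
    using K r m0 by (intro mult_right_mono powr_mono) auto
  also have "real K powr (1 - r) = real K * real K powr (- r)"
    using K by (simp add: powr_diff powr_minus divide_inverse)
  finally have "real K powr (1 - r') * ?m \<le> 2 * ?S" using 2 by simp
  then show "norm ?m \<le> 2 * ?S * norm (1 / real K powr (1 - r'))"
    using K m0 by (simp add: field_simps)
qed

text \<open>A positive limit inferior would keep \<open>g\<close> eventually above some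
  \<open>c > 0\<close>, and the series would dominate a multiple of a divergent one.\<close>

lemma liminf_zero_of_weighted_summable:
  fixes g :: "nat \<Rightarrow> real"
  assumes g: "\<And>k. 0 \<le> g k" and sum: "summable (\<lambda>k. real k powr (- r) * (g k)\<^sup>2)"
    and r: "r \<le> 1"
  shows "liminf (\<lambda>k. ereal (g k)) = 0"
proof (rule antisym)
  show "0 \<le> liminf (\<lambda>k. ereal (g k))" using g by (intro Liminf_bounded) auto
  show "liminf (\<lambda>k. ereal (g k)) \<le> 0"
  proof (rule ccontr)
    assume "\<not> ?thesis"
    then have "0 < liminf (\<lambda>k. ereal (g k))" by simp
    then obtain c where c: "0 < ereal c" "ereal c < liminf (\<lambda>k. ereal (g k))"
      using ereal_dense2 by blast
    then have ev: "\<forall>\<^sub>F k in sequentially. c < g k" using less_LiminfD[OF c(2)] by simp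
    have "summable (\<lambda>k. real k powr (- r) * c\<^sup>2)"
    proof (rule summable_comparison_test_ev[OF _ sum])
      show "\<forall>\<^sub>F k in sequentially. norm (real k powr (- r) * c\<^sup>2) \<le> real k powr (- r) * (g k)\<^sup>2"
        using ev by eventually_elim (use c in \<open>auto intro!: mult_left_mono power_mono\<close>)
    qed
    then have "summable (\<lambda>k. real k powr (- r))"
      using c(1) by (simp add: mult.commute)
    then show False using r by (simp add: summable_real_powr_iff)
  qed
qed

subsection \<open>The saddle point problem\<close>

lemma lipschitz_grad_partial:
  fixes g :: "'a::euclidean_space \<times> 'b::euclidean_space \<Rightarrow> real"
  assumes diff: "\<And>a. g differentiable (at a)" and lip: "L-lipschitz_on (A \<times> B) (grad g)"
    and mem: "x \<in> A" "x' \<in> A" "y \<in> B" "y' \<in> B"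
  shows norm_grad_x_diff_le: "norm (grad_x g x y - grad_x g x' y') \<le> L * (norm (x - x') + norm (y - y'))"
    and norm_grad_y_diff_le: "norm (grad_y g x y - grad_y g x' y') \<le> L * (norm (x - x') + norm (y - y'))"
proof -
  have "norm (grad g (x, y) - grad g (x', y')) \<le> L * norm ((x, y) - (x', y'))"
    using lipschitz_onD[OF lip, of "(x, y)" "(x', y')"] mem by (simp add: dist_norm)
  also have "norm ((x, y) - (x', y')) \<le> norm (x - x') + norm (y - y')"
    using norm_Pair_le by (metis diff_Pair)
  finally have *: "norm (grad g (x, y) - grad g (x', y')) \<le> L * (norm (x - x') + norm (y - y'))"
    using lipschitz_on_nonneg[OF lip] by (simp add: mult_left_mono)
  have fst_le: "norm (fst (grad g (x, y)) - fst (grad g (x', y'))) \<le> norm (grad g (x, y) - grad g (x', y'))"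
    and snd_le: "norm (snd (grad g (x, y)) - snd (grad g (x', y'))) \<le> norm (grad g (x, y) - grad g (x', y'))"
    by (metis fst_diff norm_fst_le prod.collapse, metis snd_diff norm_snd_le prod.collapse)
  show "norm (grad_x g x y - grad_x g x' y') \<le> L * (norm (x - x') + norm (y - y'))"
    using fst_le * by (simp add: grad_x_eq diff)
  show "norm (grad_y g x y - grad_y g x' y') \<le> L * (norm (x - x') + norm (y - y'))"
    using snd_le * by (simp add: grad_y_eq diff)
qed

lemma lipschitz_grad_quadratic_bound_x:
  fixes g :: "'a::euclidean_space \<times> 'b::euclidean_space \<Rightarrow> real"
  assumes diff: "\<And>a. g differentiable (at a)" and lip: "L-lipschitz_on (A \<times> B) (grad g)"
    and C: "convex A" "convex B" "x \<in> A" "x' \<in> A" "y \<in> B"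
  shows "\<bar>g (x', y) - g (x, y) - grad_x g x y \<bullet> (x' - x)\<bar> \<le> L * (norm (x' - x))\<^sup>2"
  using lipschitz_grad_quadratic_bound[OF diff lip, of "(x, y)" "(x', y)"] C
  by (simp add: convex_Times inner_prod_def grad_x_eq diff norm_Pair)

text \<open>\<open>L\<close> is a common Lipschitz constant of both gradients. Boundedness of
  solutions is stated for the compact set \<open>X\<close> itself and carries the existence of
  minimizers with it.\<close>

locale bilevel =
  fixes X :: "'a::euclidean_space set" and Y :: "'b::euclidean_space set"
    and F f :: "'a \<times> 'b \<Rightarrow> real" and \<mu> L :: real
  assumes X: "convex X" "compact X" and Y: "closed Y" "convex Y"
    and F_C1: "continuously_differentiable F" and F_lip: "L-lipschitz_on (X \<times> Y) (grad F)"
    and f_C1: "continuously_differentiable f" and f_lip: "L-lipschitz_on (X \<times> Y) (grad f)"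
    and \<mu>: "0 < \<mu>"
    and F_concave: "x \<in> X \<Longrightarrow> strongly_concave_on \<mu> Y (\<lambda>y. F (x, y))"
    and f_convex: "x \<in> X \<Longrightarrow> convex_on Y (\<lambda>y. f (x, y))"
    and S_bounded: "\<exists>D. bounded D \<and> (\<forall>x\<in>X. argmin_set Y f x \<inter> D \<noteq> {})"
begin

lemma F_diff: "F differentiable (at a)" and f_diff: "f differentiable (at a)"
  using F_C1 f_C1 unfolding continuously_differentiable_def by blast+

lemma L: "0 \<le> L"
  using F_lip by (rule lipschitz_on_nonneg)

lemma X_closed: "closed X"
  using X by (simp add: compact_imp_closed)

lemma Y_nonempty: "x \<in> X \<Longrightarrow> Y \<noteq> {}"
  using S_bounded by (force simp: argmin_set_def is_arg_min_def)

lemmas grad_diff_bounds =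
  norm_grad_x_diff_le[OF F_diff F_lip] norm_grad_x_diff_le[OF f_diff f_lip]
  norm_grad_y_diff_le[OF F_diff F_lip] norm_grad_y_diff_le[OF f_diff f_lip]

lemma F_first_order:
  assumes "x \<in> X" "y \<in> Y" "y' \<in> Y"
  shows "F (x, y') \<le> F (x, y) + (y' - y) \<bullet> grad_y F x y - \<mu> / 2 * (norm (y' - y))\<^sup>2"
  using strongly_concave_first_order[OF F_concave _ _ has_derivative_grad_y[OF F_diff]] assms by blast

lemma f_first_order:
  assumes "x \<in> X" "y \<in> Y" "y' \<in> Y"
  shows "f (x, y) + (y' - y) \<bullet> grad_y f x y \<le> f (x, y')"
proof -
  have "((\<lambda>y'. - f (x, y')) has_derivative (\<lambda>h. h \<bullet> - grad_y f x y)) (at y)"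
    using has_derivative_minus[OF has_derivative_grad_y[OF f_diff]] by simp
  from strongly_concave_first_order[OF convex_on_imp_strongly_concave_on_uminus[OF f_convex[OF assms(1)]]
      assms(2,3) this]
  show ?thesis by simp
qed

text \<open>The first-order inequalities at the two points are added with the roles exchanged; the
  two halves of the modulus add up to \<open>\<mu>\<close>.\<close>

lemma F_monotone:
  assumes "x \<in> X" "y \<in> Y" "y' \<in> Y"
  shows "\<mu> * (norm (y - y'))\<^sup>2 \<le> - ((grad_y F x y - grad_y F x y') \<bullet> (y - y'))"
proof -
  have "norm (y' - y) = norm (y - y')" by (rule norm_minus_commute)
  then show ?thesis
    using F_first_order[of x y y'] F_first_order[of x y' y] assms
    by (simp add: inner_diff_left inner_diff_right inner_commute)
qed

lemma f_monotone:
  assumes "x \<in> X" "y \<in> Y" "y' \<in> Y"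
  shows "0 \<le> (grad_y f x y - grad_y f x y') \<bullet> (y - y')"
  using f_first_order[of x y y'] f_first_order[of x y' y] assms
  by (simp add: inner_diff_left inner_diff_right inner_commute)

section \<open>The saddle operator and its variational inequality\<close>

text \<open>The partial gradients of \<open>psi\<close> in \<open>y\<close> and \<open>z\<close>,
  with the sign of the concave variable reversed so that the map is monotone. A projected step along
  its negative is the inner step of the algorithm.\<close>

definition saddle_op :: "real \<Rightarrow> real \<Rightarrow> 'a \<Rightarrow> 'b \<times> 'b \<Rightarrow> 'b \<times> 'b" where
  "saddle_op \<rho> \<sigma> x u = (- dir_y F f \<rho> \<sigma> x (fst u) (snd u), dir_z f \<rho> \<sigma> x (fst u) (snd u))"

text \<open>The coupling \<open>- \<sigma> * inner y z\<close> contributes a skew term that cancels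
  in the pairing. Strong concavity of \<open>F\<close> and the quadratic term in \<open>z\<close>
  remain, and the \<open>f\<close> terms are nonnegative.\<close>

lemma saddle_op_monotone_split:
  assumes x: "x \<in> X" and Y': "y \<in> Y" "z \<in> Y" "y' \<in> Y" "z' \<in> Y" and par: "0 \<le> \<rho>"
  shows "\<mu> * (norm (y - y'))\<^sup>2 + \<sigma> * (norm (z - z'))\<^sup>2
    \<le> (saddle_op \<rho> \<sigma> x (y, z) - saddle_op \<rho> \<sigma> x (y', z')) \<bullet> ((y, z) - (y', z'))"
proof -
  have eq: "(saddle_op \<rho> \<sigma> x (y, z) - saddle_op \<rho> \<sigma> x (y', z')) \<bullet> ((y, z) - (y', z'))
      = - ((grad_y F x y - grad_y F x y') \<bullet> (y - y')) + \<rho> * ((grad_y f x y - grad_y f x y') \<bullet> (y - y'))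
        + \<rho> * ((grad_y f x z - grad_y f x z') \<bullet> (z - z')) + \<sigma> * (norm (z - z'))\<^sup>2"
    unfolding saddle_op_def dir_y_def dir_z_def power2_norm_eq_inner
    by (simp add: inner_prod_def inner_diff_left inner_diff_right inner_add_left inner_add_right
        inner_commute algebra_simps)
  have "0 \<le> \<rho> * ((grad_y f x y - grad_y f x y') \<bullet> (y - y'))"
    "0 \<le> \<rho> * ((grad_y f x z - grad_y f x z') \<bullet> (z - z'))"
    using par f_monotone x Y' by (auto intro!: mult_nonneg_nonneg)
  then show ?thesis
    unfolding eq using F_monotone[OF x Y'(1,3)] by linarith
qed

lemma saddle_op_strongly_monotone:
  assumes x: "x \<in> X" and u: "u \<in> Y \<times> Y" and v: "v \<in> Y \<times> Y" and par: "0 \<le> \<rho>"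
  shows "min \<mu> \<sigma> * (norm (u - v))\<^sup>2 \<le> (saddle_op \<rho> \<sigma> x u - saddle_op \<rho> \<sigma> x v) \<bullet> (u - v)"
proof -
  obtain y z y' z' where uv: "u = (y, z)" "v = (y', z')" by (metis prod.exhaust)
  have "min \<mu> \<sigma> * (norm (u - v))\<^sup>2 = min \<mu> \<sigma> * (norm (y - y'))\<^sup>2 + min \<mu> \<sigma> * (norm (z - z'))\<^sup>2"
    by (simp add: uv norm_Pair distrib_left)
  also have "\<dots> \<le> \<mu> * (norm (y - y'))\<^sup>2 + \<sigma> * (norm (z - z'))\<^sup>2"
    by (intro add_mono mult_right_mono) auto
  also have "\<dots> \<le> (saddle_op \<rho> \<sigma> x u - saddle_op \<rho> \<sigma> x v) \<bullet> (u - v)"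
    using saddle_op_monotone_split[of x y z y' z' \<rho> \<sigma>] x u v par by (simp add: uv)
  finally show ?thesis .
qed

lemma saddle_op_lipschitz:
  assumes x: "x \<in> X" and u: "u \<in> Y \<times> Y" and v: "v \<in> Y \<times> Y" and par: "0 \<le> \<rho>" "0 \<le> \<sigma>"
  shows "norm (saddle_op \<rho> \<sigma> x u - saddle_op \<rho> \<sigma> x v) \<le> 2 * (L * (1 + \<rho>) + 2 * \<sigma>) * norm (u - v)"
proof -
  obtain y z y' z' where uv: "u = (y, z)" "v = (y', z')" by (metis prod.exhaust)
  have mem: "y \<in> Y" "z \<in> Y" "y' \<in> Y" "z' \<in> Y" using u v uv by auto
  define e where "e = norm (u - v)"
  have e: "norm (y - y') \<le> e" "norm (z - z') \<le> e"
    using norm_fst_le[of "y - y'" "z - z'"] norm_snd_le[of "z - z'" "y - y'"] by (auto simp: e_def uv)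
  have Le: "L * norm (y - y') \<le> L * e" "L * norm (z - z') \<le> L * e"
    using e L by (auto intro: mult_left_mono)
  let ?a = "- (grad_y F x y - grad_y F x y')" and ?b = "\<rho> *\<^sub>R (grad_y f x y - grad_y f x y')"
    and ?c = "\<sigma> *\<^sub>R (z - z')" and ?d = "\<rho> *\<^sub>R (grad_y f x z - grad_y f x z')"
    and ?g = "\<sigma> *\<^sub>R (y - y')"
  have "saddle_op \<rho> \<sigma> x u - saddle_op \<rho> \<sigma> x v = (?a + ?b + ?c, ?d + ?c - ?g)"
    by (simp add: saddle_op_def uv dir_y_def dir_z_def algebra_simps)
  then have "norm (saddle_op \<rho> \<sigma> x u - saddle_op \<rho> \<sigma> x v) \<le> norm (?a + ?b + ?c) + norm (?d + ?c - ?g)"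
    using norm_Pair_le by metis
  also have "\<dots> \<le> (norm ?a + norm ?b + norm ?c) + (norm ?d + norm ?c + norm ?g)"
    by (intro add_mono order_trans[OF norm_triangle_ineq4] order_trans[OF norm_triangle_ineq] order_refl)
  also have "norm ?a \<le> L * e"
    using grad_diff_bounds(3)[of x x y y'] x mem Le by (simp add: norm_minus_commute)
  also have "norm ?b \<le> \<rho> * (L * e)"
    using grad_diff_bounds(4)[of x x y y'] x mem Le par by (auto intro!: mult_left_mono)
  also have "norm ?d \<le> \<rho> * (L * e)"
    using grad_diff_bounds(4)[of x x z z'] x mem Le par by (auto intro!: mult_left_mono)
  also have "norm ?c \<le> \<sigma> * e" using e par by (auto intro!: mult_left_mono)
  also have "norm ?g \<le> \<sigma> * e" using e par by (auto intro!: mult_left_mono)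
  finally have "norm (saddle_op \<rho> \<sigma> x u - saddle_op \<rho> \<sigma> x v)
      \<le> (L * e + \<rho> * (L * e) + \<sigma> * e) + (\<rho> * (L * e) + \<sigma> * e + \<sigma> * e)"
    by simp
  also have "\<dots> = (L * (1 + 2 * \<rho>) + 3 * \<sigma>) * e" by (simp add: algebra_simps)
  \<comment> \<open>The constant is rounded up to the form in which the inner step size condition is
    stated.\<close>
  also have "\<dots> \<le> 2 * (L * (1 + \<rho>) + 2 * \<sigma>) * e"
    using L par by (intro mult_right_mono) (auto simp: algebra_simps e_def)
  finally show ?thesis by (simp add: e_def)
qed

text \<open>Testing with \<open>(w, z)\<close> and \<open>(y, w)\<close> separates the two blocks.
  Strong concavity in \<open>y\<close> and strong convexity in \<open>z\<close> supply the quadratic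
  gaps.\<close>

lemma variational_imp_saddle:
  assumes x: "x \<in> X" and mem: "y \<in> Y" "z \<in> Y" and par: "0 < \<rho>" "0 < \<sigma>"
    and vi: "\<forall>w\<in>Y \<times> Y. 0 \<le> saddle_op \<rho> \<sigma> x (y, z) \<bullet> (w - (y, z))"
    and w: "w \<in> Y"
  shows "psi F f \<rho> \<sigma> x w z \<le> psi F f \<rho> \<sigma> x y z - \<mu> / 2 * (norm (w - y))\<^sup>2"
    and "psi F f \<rho> \<sigma> x y z + \<sigma> / 2 * (norm (w - z))\<^sup>2 \<le> psi F f \<rho> \<sigma> x y w"
proof -
  have vy: "0 \<le> (- dir_y F f \<rho> \<sigma> x y z) \<bullet> (w - y)" using bspec[OF vi, of "(w, z)"] w mem
    by (simp add: saddle_op_def inner_prod_def)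
  have "\<rho> * (f (x, y) + (w - y) \<bullet> grad_y f x y) \<le> \<rho> * f (x, w)"
    using f_first_order[OF x mem(1) w] par by (intro mult_left_mono) auto
  then show "psi F f \<rho> \<sigma> x w z \<le> psi F f \<rho> \<sigma> x y z - \<mu> / 2 * (norm (w - y))\<^sup>2"
    using vy F_first_order[OF x mem(1) w] unfolding psi_def dir_y_def
    by (simp add: inner_diff_left inner_diff_right inner_commute algebra_simps)
  have vz: "0 \<le> dir_z f \<rho> \<sigma> x y z \<bullet> (w - z)" using bspec[OF vi, of "(y, w)"] w mem
    by (simp add: saddle_op_def inner_prod_def)
  have "\<rho> * (f (x, z) + (w - z) \<bullet> grad_y f x z) \<le> \<rho> * f (x, w)"
    using f_first_order[OF x mem(2) w] par by (intro mult_left_mono) auto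
  then show "psi F f \<rho> \<sigma> x y z + \<sigma> / 2 * (norm (w - z))\<^sup>2 \<le> psi F f \<rho> \<sigma> x y w"
    using vz unfolding psi_def dir_z_def power2_norm_eq_inner
    by (simp add: inner_diff_left inner_diff_right inner_add_left inner_add_right inner_commute
        algebra_simps diff_divide_distrib add_divide_distrib)
qed

text \<open>\<open>ustar\<close> is a definite description, so a saddle point must be shown to exist
  and to be unique. The solution of the variational inequality provides it.\<close>

lemma ustar_props:
  assumes x: "x \<in> X" and par: "0 < \<rho>" "0 < \<sigma>"
  shows ustar_mem: "ustar Y F f \<rho> \<sigma> x \<in> Y \<times> Y"
    and ustar_variational: "\<And>w. w \<in> Y \<times> Y \<Longrightarrow>
      0 \<le> saddle_op \<rho> \<sigma> x (ustar Y F f \<rho> \<sigma> x) \<bullet> (w - ustar Y F f \<rho> \<sigma> x)"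
proof -
  have "\<exists>u\<in>Y \<times> Y. \<forall>w\<in>Y \<times> Y. 0 \<le> saddle_op \<rho> \<sigma> x u \<bullet> (w - u)"
  proof (rule strongly_monotone_variational_exists)
    show "convex (Y \<times> Y)" "closed (Y \<times> Y)" "Y \<times> Y \<noteq> {}"
      using Y Y_nonempty[OF x] by (auto intro: convex_Times closed_Times)
    show "0 < min \<mu> \<sigma>" using \<mu> par by simp
    fix u v assume "u \<in> Y \<times> Y" "v \<in> Y \<times> Y"
    then show "min \<mu> \<sigma> * (norm (u - v))\<^sup>2 \<le> (saddle_op \<rho> \<sigma> x u - saddle_op \<rho> \<sigma> x v) \<bullet> (u - v)"
      "norm (saddle_op \<rho> \<sigma> x u - saddle_op \<rho> \<sigma> x v) \<le> 2 * (L * (1 + \<rho>) + 2 * \<sigma>) * norm (u - v)"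
      using saddle_op_strongly_monotone saddle_op_lipschitz x par by auto
  qed
  then obtain y z where mem: "y \<in> Y" "z \<in> Y"
    and vi: "\<forall>w\<in>Y \<times> Y. 0 \<le> saddle_op \<rho> \<sigma> x (y, z) \<bullet> (w - (y, z))"
    by auto
  note sad = variational_imp_saddle[OF x mem par vi]
  have "is_saddle_point Y (psi F f \<rho> \<sigma> x) (y, z)"
    unfolding is_saddle_point_def using mem sad \<mu> par
    by (smt (verit) fst_conv snd_conv mult_nonneg_nonneg zero_le_power2 divide_nonneg_nonneg)
  \<comment> \<open>For a second saddle point \<open>(y', z')\<close> the values at
    \<open>(y, z')\<close>, \<open>(y', z')\<close>, \<open>(y', z)\<close> increase in this order.
    This runs against the quadratic gaps around \<open>(y, z)\<close>, so both gaps vanish.\<close>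
  moreover have "u = (y, z)" if u: "is_saddle_point Y (psi F f \<rho> \<sigma> x) u" for u
  proof -
    obtain y' z' where u': "u = (y', z')" by fastforce
    have mem': "y' \<in> Y" "z' \<in> Y" using u by (auto simp: u' is_saddle_point_def)
    have "psi F f \<rho> \<sigma> x y z' \<le> psi F f \<rho> \<sigma> x y' z'" "psi F f \<rho> \<sigma> x y' z' \<le> psi F f \<rho> \<sigma> x y' z"
      using u mem by (auto simp: u' is_saddle_point_def)
    then have "\<mu> / 2 * (norm (y' - y))\<^sup>2 + \<sigma> / 2 * (norm (z' - z))\<^sup>2 \<le> 0"
      using sad(1)[OF mem'(1)] sad(2)[OF mem'(2)] by linarith
    moreover have "0 \<le> \<mu> / 2 * (norm (y' - y))\<^sup>2" "0 \<le> \<sigma> / 2 * (norm (z' - z))\<^sup>2"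
      using \<mu> par by auto
    ultimately have "\<mu> / 2 * (norm (y' - y))\<^sup>2 = 0" "\<sigma> / 2 * (norm (z' - z))\<^sup>2 = 0" by linarith+
    then show ?thesis using \<mu> par by (simp add: u')
  qed
  ultimately have "ustar Y F f \<rho> \<sigma> x = (y, z)"
    unfolding ustar_def by (rule the_equality)
  then show "ustar Y F f \<rho> \<sigma> x \<in> Y \<times> Y"
    and "\<And>w. w \<in> Y \<times> Y \<Longrightarrow>
      0 \<le> saddle_op \<rho> \<sigma> x (ustar Y F f \<rho> \<sigma> x) \<bullet> (w - ustar Y F f \<rho> \<sigma> x)"
    using mem vi by auto
qed

section \<open>Saddle values and their inequalities\<close>

abbreviation ys where "ys \<rho> \<sigma> x \<equiv> fst (ustar Y F f \<rho> \<sigma> x)"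
abbreviation zs where "zs \<rho> \<sigma> x \<equiv> snd (ustar Y F f \<rho> \<sigma> x)"

text \<open>For \<open>x \<in> X\<close> and positive parameters this is the minimax value \<phi>_k
  of the problem, since a saddle point realises both the minimum and the maximum.\<close>

definition val :: "real \<Rightarrow> real \<Rightarrow> 'a \<Rightarrow> real" where
  "val \<rho> \<sigma> x = psi F f \<rho> \<sigma> x (ys \<rho> \<sigma> x) (zs \<rho> \<sigma> x)"

lemma saddle_ineqs:
  assumes x: "x \<in> X" and par: "0 < \<rho>" "0 < \<sigma>"
  shows ys_mem: "ys \<rho> \<sigma> x \<in> Y" and zs_mem: "zs \<rho> \<sigma> x \<in> Y"
    and psi_le_val_strong:
      "w \<in> Y \<Longrightarrow> psi F f \<rho> \<sigma> x w (zs \<rho> \<sigma> x) \<le> val \<rho> \<sigma> x - \<mu> / 2 * (norm (w - ys \<rho> \<sigma> x))\<^sup>2"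
    and val_le_psi_strong:
      "w \<in> Y \<Longrightarrow> val \<rho> \<sigma> x + \<sigma> / 2 * (norm (w - zs \<rho> \<sigma> x))\<^sup>2 \<le> psi F f \<rho> \<sigma> x (ys \<rho> \<sigma> x) w"
    and psi_le_val: "w \<in> Y \<Longrightarrow> psi F f \<rho> \<sigma> x w (zs \<rho> \<sigma> x) \<le> val \<rho> \<sigma> x"
    and val_le_psi: "w \<in> Y \<Longrightarrow> val \<rho> \<sigma> x \<le> psi F f \<rho> \<sigma> x (ys \<rho> \<sigma> x) w"
proof -
  show 1: "ys \<rho> \<sigma> x \<in> Y" "zs \<rho> \<sigma> x \<in> Y" using ustar_mem[OF assms] by (auto simp: mem_Times_iff)
  have vi: "\<forall>w\<in>Y \<times> Y. 0 \<le> saddle_op \<rho> \<sigma> x (ys \<rho> \<sigma> x, zs \<rho> \<sigma> x) \<bullet> (w - (ys \<rho> \<sigma> x, zs \<rho> \<sigma> x))"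
    using ustar_variational[OF assms] by simp
  have nonneg: "0 \<le> \<mu> / 2 * (norm (w - ys \<rho> \<sigma> x))\<^sup>2" "0 \<le> \<sigma> / 2 * (norm (w - zs \<rho> \<sigma> x))\<^sup>2" for w
    using \<mu> par by auto
  assume w: "w \<in> Y"
  note ineqs = variational_imp_saddle[OF x 1 par vi w, folded val_def]
  show "psi F f \<rho> \<sigma> x w (zs \<rho> \<sigma> x) \<le> val \<rho> \<sigma> x - \<mu> / 2 * (norm (w - ys \<rho> \<sigma> x))\<^sup>2"
    "val \<rho> \<sigma> x + \<sigma> / 2 * (norm (w - zs \<rho> \<sigma> x))\<^sup>2 \<le> psi F f \<rho> \<sigma> x (ys \<rho> \<sigma> x) w"
    by (fact ineqs)+
  then show "psi F f \<rho> \<sigma> x w (zs \<rho> \<sigma> x) \<le> val \<rho> \<sigma> x"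
    "val \<rho> \<sigma> x \<le> psi F f \<rho> \<sigma> x (ys \<rho> \<sigma> x) w"
    using nonneg[of w] by linarith+
qed

end

subsection \<open>Bounds uniform in the parameters, and descent of the saddle value\<close>

context bilevel
begin

text \<open>\<open>M\<close> may depend on the cap \<open>\<tau>\<close> for
  \<open>\<sigma>\<close>, but not on \<open>\<rho>\<close>, which grows without bound along the
  iteration. The clause with \<open>f\<close> says that \<open>zs\<close> minimizes \<open>f\<close>
  up to order \<sigma> / \<rho>; this keeps the growth of the value summable.\<close>

definition uniform_bound :: "real \<Rightarrow> real \<Rightarrow> bool" where
  "uniform_bound \<tau> M \<longleftrightarrow> (\<forall>x\<in>X. \<forall>\<rho>>0. \<forall>\<sigma>>0. \<sigma> \<le> \<tau> \<longrightarrow>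
     norm (ys \<rho> \<sigma> x) \<le> M \<and> norm (zs \<rho> \<sigma> x) \<le> M \<and>
     norm (grad_y f x (ys \<rho> \<sigma> x)) \<le> M \<and> norm (grad_y f x (zs \<rho> \<sigma> x)) \<le> M \<and>
     (\<forall>w\<in>Y. \<rho> * (f (x, zs \<rho> \<sigma> x) - f (x, w)) \<le> M * \<sigma>) \<and>
     - M \<le> val \<rho> \<sigma> x)"

lemma compact_bounds:
  assumes "compact (K :: ('a \<times> 'b) set)"
  obtains G where "0 \<le> G" "\<And>a. a \<in> K \<Longrightarrow> norm (grad F a) \<le> G" "\<And>a. a \<in> K \<Longrightarrow> norm (grad f a) \<le> G"
    "\<And>a. a \<in> K \<Longrightarrow> \<bar>F a\<bar> \<le> G"
proof -
  have "continuous_on K (grad F)" "continuous_on K (grad f)"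
    using F_C1 f_C1 by (auto simp: continuously_differentiable_def intro: continuous_on_subset)
  moreover have "continuous_on K F"
    using F_diff differentiable_imp_continuous_within
    by (intro continuous_at_imp_continuous_on) blast
  ultimately have "bounded (grad F ` K)" "bounded (grad f ` K)" "bounded (F ` K)"
    using assms by (auto intro!: compact_imp_bounded compact_continuous_image)
  then obtain G1 G2 G3 where
    "\<And>a. a \<in> K \<Longrightarrow> norm (grad F a) \<le> G1" "\<And>a. a \<in> K \<Longrightarrow> norm (grad f a) \<le> G2"
    "\<And>a. a \<in> K \<Longrightarrow> norm (F a) \<le> G3"
    unfolding bounded_iff by (metis image_eqI)
  then show ?thesis
    by (intro that[of "max 0 (max G1 (max G2 G3))"]) (fastforce simp: le_max_iff_disj)+
qed

text \<open>Comparison with a minimizer \<open>s\<close> gives the differences of \<open>f\<close> a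
  sign, so \<open>\<rho>\<close> drops out. Moreover \<open>zs\<close> is the proximal image of
  \<open>ys\<close> for a multiple of \<open>f\<close> on \<open>Y\<close>, and \<open>s\<close> is
  fixed by that map; the first bound is its nonexpansiveness.\<close>

lemma saddle_near_minimizer:
  assumes x: "x \<in> X" and par: "0 < \<rho>" "0 < \<sigma>"
    and s: "s \<in> Y" "\<And>w. w \<in> Y \<Longrightarrow> f (x, s) \<le> f (x, w)"
  shows "norm (zs \<rho> \<sigma> x - s) \<le> norm (ys \<rho> \<sigma> x - s)"
    and "\<mu> * norm (ys \<rho> \<sigma> x - s) \<le> norm (grad_y F x s) + \<sigma> * norm s"
proof -
  define y z where "y = ys \<rho> \<sigma> x" and "z = zs \<rho> \<sigma> x"
  note mem = ys_mem[OF x par, folded y_def] zs_mem[OF x par, folded z_def]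
  have "\<rho> * f (x, s) \<le> \<rho> * f (x, z)" using s(2)[OF mem(2)] par by simp
  then have "\<sigma> * ((norm z)\<^sup>2 / 2 - y \<bullet> z + (norm (s - z))\<^sup>2 / 2) \<le> \<sigma> * ((norm s)\<^sup>2 / 2 - y \<bullet> s)"
    using val_le_psi_strong[OF x par s(1)] unfolding val_def y_def[symmetric] z_def[symmetric] psi_def
    by (simp add: algebra_simps)
  then have "(norm z)\<^sup>2 / 2 - y \<bullet> z + (norm (s - z))\<^sup>2 / 2 \<le> (norm s)\<^sup>2 / 2 - y \<bullet> s"
    using par by (simp only: mult_le_cancel_left_pos)
  \<comment> \<open>Firm nonexpansiveness of the proximal map at \<open>y\<close> and
    \<open>s\<close>. It also gives the sign that later lets \<open>s\<close> replace
    \<open>z\<close> in the inner product.\<close>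
  then have zz: "(norm (z - s))\<^sup>2 \<le> (y - s) \<bullet> (z - s)"
    unfolding power2_norm_eq_inner
    by (simp add: inner_diff_left inner_diff_right inner_commute diff_divide_distrib add_divide_distrib)
  also have "\<dots> \<le> norm (y - s) * norm (z - s)" by (rule norm_cauchy_schwarz)
  finally show "norm (z - s) \<le> norm (y - s)"
    by (cases "z = s") (simp_all add: power2_eq_square)
  have "\<rho> * f (x, s) \<le> \<rho> * f (x, y)" using s(2)[OF mem(1)] par by simp
  then have "F (x, s) + \<mu> / 2 * (norm (s - y))\<^sup>2 \<le> F (x, y) + \<sigma> * ((s - y) \<bullet> z)"
    using psi_le_val_strong[OF x par s(1)] unfolding val_def y_def[symmetric] z_def[symmetric] psi_def
    by (simp add: algebra_simps inner_diff_left)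
  moreover have "F (x, y) \<le> F (x, s) + (y - s) \<bullet> grad_y F x s - \<mu> / 2 * (norm (y - s))\<^sup>2"
    by (rule F_first_order[OF x s(1) mem(1)])
  ultimately have "\<mu> * (norm (y - s))\<^sup>2 \<le> (y - s) \<bullet> grad_y F x s + \<sigma> * ((s - y) \<bullet> z)"
    by (simp add: norm_minus_commute)
  also have "(s - y) \<bullet> z \<le> (s - y) \<bullet> s"
  proof -
    have "0 \<le> (y - s) \<bullet> (z - s)" using zz by (rule order_trans[rotated]) simp
    then show ?thesis by (simp add: inner_diff_left inner_diff_right)
  qed
  also have "\<dots> \<le> norm (y - s) * norm s" using norm_cauchy_schwarz[of "s - y" s] by (simp add: norm_minus_commute)
  also have "(y - s) \<bullet> grad_y F x s \<le> norm (y - s) * norm (grad_y F x s)" by (rule norm_cauchy_schwarz)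
  finally have "norm (y - s) * (\<mu> * norm (y - s)) \<le> norm (y - s) * (norm (grad_y F x s) + \<sigma> * norm s)"
    using par by (simp add: power2_eq_square algebra_simps)
  then show "\<mu> * norm (y - s) \<le> norm (grad_y F x s) + \<sigma> * norm s"
    using par by (cases "y = s") simp_all
qed

text \<open>Minimizers can be chosen in one ball, and saddle points stay within a bounded distance
  of them whatever \<open>\<rho>\<close> is. Compactness of \<open>X\<close> times a ball then
  bounds the gradients.\<close>

lemma uniform_bound_exists: "\<exists>M\<ge>0. uniform_bound \<tau> M"
proof (cases "0 < \<tau>")
  case \<tau>: True
  obtain D where "bounded D" and D: "\<And>x. x \<in> X \<Longrightarrow> argmin_set Y f x \<inter> D \<noteq> {}"
    using S_bounded by blast
  then obtain R where R: "\<And>w. w \<in> D \<Longrightarrow> norm w \<le> R" "0 < R" unfolding bounded_pos by blast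
  obtain G where G: "0 \<le> G" "\<And>a. a \<in> X \<times> cball 0 R \<Longrightarrow> norm (grad F a) \<le> G"
      "\<And>a. a \<in> X \<times> cball 0 R \<Longrightarrow> \<bar>F a\<bar> \<le> G"
    using compact_bounds[of "X \<times> cball 0 R"] X by (metis compact_Times compact_cball)
  \<comment> \<open>The second summand bounds the distance from \<open>ys\<close> to the minimizer,
    hence also that from \<open>zs\<close>.\<close>
  define T where "T = R + (G + \<tau> * R) / \<mu>"
  have T: "0 \<le> T" using G R \<tau> \<mu> by (simp add: T_def)
  obtain H where H: "0 \<le> H" "\<And>a. a \<in> X \<times> cball 0 T \<Longrightarrow> norm (grad f a) \<le> H"
    using compact_bounds[of "X \<times> cball 0 T"] X by (metis compact_Times compact_cball)
  \<comment> \<open>One summand per group of clauses: saddle points, gradients of \<open>f\<close>,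
    optimality gap of \<open>zs\<close>, lower bound of the value.\<close>
  define M where "M = T + H + (R\<^sup>2 / 2 + T * R + T\<^sup>2) + (G + \<tau> * (R\<^sup>2 / 2))"
  have nonneg: "0 \<le> R\<^sup>2 / 2 + T * R + T\<^sup>2" "0 \<le> G + \<tau> * (R\<^sup>2 / 2)" using T R G \<tau> by auto
  have "uniform_bound \<tau> M"
    unfolding uniform_bound_def
  proof (intro ballI allI impI)
    fix x and \<rho> \<sigma> :: real assume x: "x \<in> X" and par: "0 < \<rho>" "0 < \<sigma>" and \<sigma>\<tau>: "\<sigma> \<le> \<tau>"
    obtain s where "s \<in> argmin_set Y f x" "s \<in> D" using D[OF x] by blast
    then have s: "s \<in> Y" "\<And>w. w \<in> Y \<Longrightarrow> f (x, s) \<le> f (x, w)" "norm s \<le> R"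
      using R by (auto simp: argmin_set_def is_arg_min_linorder)
    define y z where "y = ys \<rho> \<sigma> x" and "z = zs \<rho> \<sigma> x"
    have mem: "y \<in> Y" "z \<in> Y" using ys_mem zs_mem x par by (auto simp: y_def z_def)
    note near = saddle_near_minimizer[OF x par s(1,2), folded y_def z_def]
    have "norm (grad_y F x s) \<le> norm (grad F (x, s))"
      unfolding grad_y_eq[OF F_diff] by (metis norm_snd_le prod.collapse)
    then have "norm (grad_y F x s) \<le> G" using G(2)[of "(x, s)"] x s by simp
    moreover have "\<sigma> * norm s \<le> \<tau> * R" using s \<sigma>\<tau> par by (intro mult_mono) auto
    ultimately have "\<mu> * norm (y - s) \<le> G + \<tau> * R" using near(2) by linarith
    then have "norm (y - s) \<le> (G + \<tau> * R) / \<mu>" using \<mu> by (simp add: field_simps)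
    then have yz: "norm y \<le> T" "norm z \<le> T"
      using near(1) s(3) norm_triangle_ineq2[of y s] norm_triangle_ineq2[of z s]
      by (auto simp: T_def)
    have gf: "norm (grad_y f x w) \<le> H" if "norm w \<le> T" for w
    proof -
      have "norm (grad_y f x w) \<le> norm (grad f (x, w))"
        unfolding grad_y_eq[OF f_diff] by (metis norm_snd_le prod.collapse)
      then show ?thesis using H(2)[of "(x, w)"] x that by simp
    qed
    \<comment> \<open>The minimizer \<open>s\<close> is the worst case for \<open>w\<close>.
      Optimality of \<open>z\<close> against \<open>s\<close> then leaves only regularisation terms,
      all with the factor \<open>\<sigma>\<close>.\<close>
    have fz: "\<rho> * (f (x, z) - f (x, w)) \<le> M * \<sigma>" if w: "w \<in> Y" for w
    proof -
      have "\<rho> * (f (x, z) - f (x, w)) \<le> \<rho> * (f (x, z) - f (x, s))"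
        using s(2)[OF w] par by simp
      also have "\<dots> \<le> \<sigma> * ((norm s)\<^sup>2 / 2 - y \<bullet> s + y \<bullet> z - (norm z)\<^sup>2 / 2)"
        using val_le_psi[OF x par s(1)] unfolding val_def y_def[symmetric] z_def[symmetric] psi_def
        by (simp add: algebra_simps)
      also have "\<dots> \<le> \<sigma> * M"
      proof (rule mult_left_mono)
        have "- (y \<bullet> s) \<le> norm y * norm s" using norm_cauchy_schwarz[of "- y" s] by simp
        also have "\<dots> \<le> T * R" using yz s T by (intro mult_mono) auto
        finally have 1: "- (y \<bullet> s) \<le> T * R" .
        have "y \<bullet> z \<le> norm y * norm z" by (rule norm_cauchy_schwarz)
        also have "\<dots> \<le> T * T" using yz T by (intro mult_mono) auto
        finally have 2: "y \<bullet> z \<le> T\<^sup>2" by (simp add: power2_eq_square)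
        have 3: "(norm s)\<^sup>2 \<le> R\<^sup>2" using s by (intro power_mono) auto
        have "0 \<le> (norm z)\<^sup>2" by simp
        then show "(norm s)\<^sup>2 / 2 - y \<bullet> s + y \<bullet> z - (norm z)\<^sup>2 / 2 \<le> M"
          using 1 2 3 T H nonneg unfolding M_def by linarith
      qed (use par in simp)
      finally show ?thesis by (simp add: mult.commute)
    qed
    \<comment> \<open>The maximizing player may play \<open>s\<close>: the penalty term then has a
      favourable sign, and completing the square controls the regularisation.\<close>
    have lower: "- M \<le> val \<rho> \<sigma> x"
    proof -
      have "\<rho> * (f (x, s) - f (x, z)) \<le> 0"
        using s(2)[OF mem(2)] par by (simp add: mult_le_0_iff)
      moreover have "- (\<sigma> * (R\<^sup>2 / 2)) \<le> \<sigma> / 2 * (norm z)\<^sup>2 - \<sigma> * (s \<bullet> z)"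
      proof -
        have "0 \<le> (norm (z - s))\<^sup>2" by simp
        then have "0 \<le> (norm z)\<^sup>2 - 2 * (s \<bullet> z) + (norm s)\<^sup>2"
          unfolding power2_norm_eq_inner by (simp add: inner_diff_left inner_diff_right inner_commute)
        moreover have "(norm s)\<^sup>2 \<le> R\<^sup>2" using s by (intro power_mono) auto
        ultimately have "- (R\<^sup>2 / 2) \<le> (norm z)\<^sup>2 / 2 - s \<bullet> z" by linarith
        then have "\<sigma> * - (R\<^sup>2 / 2) \<le> \<sigma> * ((norm z)\<^sup>2 / 2 - s \<bullet> z)"
          using par by (intro mult_left_mono) auto
        then show ?thesis by (simp add: algebra_simps)
      qed
      moreover have "\<sigma> * (R\<^sup>2 / 2) \<le> \<tau> * (R\<^sup>2 / 2)" using \<sigma>\<tau> by (intro mult_right_mono) auto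
      moreover have "- G \<le> F (x, s)" using G(3)[of "(x, s)"] x s by simp
      ultimately have "- (G + \<tau> * (R\<^sup>2 / 2)) \<le> psi F f \<rho> \<sigma> x s z"
        unfolding psi_def by linarith
      also have "\<dots> \<le> val \<rho> \<sigma> x" using psi_le_val[OF x par s(1)] by (simp add: z_def)
      finally show ?thesis using T H nonneg unfolding M_def by linarith
    qed
    show "norm (ys \<rho> \<sigma> x) \<le> M \<and> norm (zs \<rho> \<sigma> x) \<le> M \<and>
       norm (grad_y f x (ys \<rho> \<sigma> x)) \<le> M \<and> norm (grad_y f x (zs \<rho> \<sigma> x)) \<le> M \<and>
       (\<forall>w\<in>Y. \<rho> * (f (x, zs \<rho> \<sigma> x) - f (x, w)) \<le> M * \<sigma>) \<and> - M \<le> val \<rho> \<sigma> x"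
      using yz gf[OF yz(1)] gf[OF yz(2)] fz lower T H nonneg
      unfolding y_def[symmetric] z_def[symmetric] M_def by (smt (verit))
  qed
  moreover have "0 \<le> M" using T H nonneg by (simp add: M_def)
  ultimately show ?thesis by blast
\<comment> \<open>For \<open>\<tau> \<le> 0\<close> no positive \<open>\<sigma>\<close> qualifies
  and the bound is vacuous.\<close>
qed (auto simp: uniform_bound_def)

section \<open>Sensitivity of the saddle point and of its value\<close>

lemma ustar_lipschitz:
  assumes x: "x \<in> X" "x' \<in> X" and par: "0 < \<rho>" "0 < \<sigma>"
  shows "min \<mu> \<sigma> * norm (ustar Y F f \<rho> \<sigma> x - ustar Y F f \<rho> \<sigma> x') \<le> 2 * L * (1 + \<rho>) * norm (x - x')"
proof -
  let ?v = "ustar Y F f \<rho> \<sigma> x'"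
  have mem: "ys \<rho> \<sigma> x' \<in> Y" "zs \<rho> \<sigma> x' \<in> Y" using ys_mem zs_mem x par by auto
  have "min \<mu> \<sigma> * norm (ustar Y F f \<rho> \<sigma> x - ?v) \<le> norm (saddle_op \<rho> \<sigma> x' ?v - saddle_op \<rho> \<sigma> x ?v)"
    by (rule strongly_monotone_variational_stability)
      (use x par in \<open>auto intro!: saddle_op_strongly_monotone ustar_variational ustar_mem\<close>)
  also have "saddle_op \<rho> \<sigma> x' ?v - saddle_op \<rho> \<sigma> x ?v
     = ((grad_y F x (fst ?v) - grad_y F x' (fst ?v)) - \<rho> *\<^sub>R (grad_y f x (fst ?v) - grad_y f x' (fst ?v)),
        - \<rho> *\<^sub>R (grad_y f x (snd ?v) - grad_y f x' (snd ?v)))"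
    by (simp add: saddle_op_def dir_y_def dir_z_def algebra_simps)
  also have "norm \<dots> \<le> (norm (grad_y F x (fst ?v) - grad_y F x' (fst ?v))
      + norm (\<rho> *\<^sub>R (grad_y f x (fst ?v) - grad_y f x' (fst ?v))))
      + norm (- \<rho> *\<^sub>R (grad_y f x (snd ?v) - grad_y f x' (snd ?v)))"
    by (rule order_trans[OF norm_Pair_le add_right_mono[OF norm_triangle_ineq4]])
  also have "\<dots> \<le> (L * norm (x - x') + \<rho> * (L * norm (x - x'))) + \<rho> * (L * norm (x - x'))"
    using grad_diff_bounds(3)[OF x mem(1) mem(1)] grad_diff_bounds(4)[OF x mem(1) mem(1)]
      grad_diff_bounds(4)[OF x mem(2) mem(2)] par
    by (intro add_mono) (auto intro!: mult_left_mono)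
  also have "\<dots> \<le> 2 * L * (1 + \<rho>) * norm (x - x')"
    using L by (simp add: algebra_simps)
  finally show ?thesis .
qed

text \<open>The operator is affine in \<open>\<rho>\<close> and \<open>\<sigma>\<close>. Its change
  is evaluated at the new saddle point, where the uniform bound controls every coefficient.\<close>

lemma ustar_parameter_change:
  assumes M: "uniform_bound \<tau> M" and x: "x \<in> X"
    and par: "0 < \<rho>" "\<rho> \<le> \<rho>'" "0 < \<sigma>'" "\<sigma>' \<le> \<sigma>" "\<sigma> \<le> \<tau>"
  shows "min \<mu> \<sigma> * norm (ustar Y F f \<rho> \<sigma> x - ustar Y F f \<rho>' \<sigma>' x)
    \<le> 2 * M * (\<rho>' - \<rho>) + 3 * M * (\<sigma> - \<sigma>')"
proof -
  let ?v = "ustar Y F f \<rho>' \<sigma>' x"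
  have bnd: "norm (fst ?v) \<le> M" "norm (snd ?v) \<le> M"
      "norm (grad_y f x (fst ?v)) \<le> M" "norm (grad_y f x (snd ?v)) \<le> M"
    using M x par unfolding uniform_bound_def by auto
  have "min \<mu> \<sigma> * norm (ustar Y F f \<rho> \<sigma> x - ?v) \<le> norm (saddle_op \<rho>' \<sigma>' x ?v - saddle_op \<rho> \<sigma> x ?v)"
    by (rule strongly_monotone_variational_stability)
      (use x par in \<open>auto intro!: saddle_op_strongly_monotone ustar_variational ustar_mem\<close>)
  also have "saddle_op \<rho>' \<sigma>' x ?v - saddle_op \<rho> \<sigma> x ?v
     = ((\<rho>' - \<rho>) *\<^sub>R grad_y f x (fst ?v) - (\<sigma> - \<sigma>') *\<^sub>R snd ?v,
        (\<rho>' - \<rho>) *\<^sub>R grad_y f x (snd ?v) - (\<sigma> - \<sigma>') *\<^sub>R (snd ?v - fst ?v))"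
    by (simp add: saddle_op_def dir_y_def dir_z_def algebra_simps)
  also have "norm \<dots> \<le> (norm ((\<rho>' - \<rho>) *\<^sub>R grad_y f x (fst ?v)) + norm ((\<sigma> - \<sigma>') *\<^sub>R snd ?v))
      + (norm ((\<rho>' - \<rho>) *\<^sub>R grad_y f x (snd ?v)) + norm ((\<sigma> - \<sigma>') *\<^sub>R (snd ?v - fst ?v)))"
    by (rule order_trans[OF norm_Pair_le add_mono[OF norm_triangle_ineq4 norm_triangle_ineq4]])
  also have "\<dots> \<le> ((\<rho>' - \<rho>) * M + (\<sigma> - \<sigma>') * M) + ((\<rho>' - \<rho>) * M + (\<sigma> - \<sigma>') * (M + M))"
    using bnd par order_trans[OF norm_triangle_ineq4 add_mono[OF bnd(2,1)]]
    by (intro add_mono) (auto intro!: mult_left_mono)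
  also have "\<dots> = 2 * M * (\<rho>' - \<rho>) + 3 * M * (\<sigma> - \<sigma>')" by (simp add: algebra_simps)
  finally show ?thesis .
qed

text \<open>The comparison point mixes the new \<open>y'\<close> with the old \<open>z\<close>:
  there the new objective is at least the new value and the old objective at most the old
  value.\<close>

lemma val_parameter_change:
  assumes M: "uniform_bound \<tau> M" and x: "x \<in> X"
    and par: "0 < \<rho>" "\<rho> \<le> \<rho>'" "0 < \<sigma>'" "\<sigma>' \<le> \<sigma>" "\<sigma> \<le> \<tau>"
  shows "val \<rho>' \<sigma>' x \<le> val \<rho> \<sigma> x + (\<rho>' - \<rho>) * (M * \<sigma> / \<rho>) + (\<sigma> - \<sigma>') * M\<^sup>2"
proof -
  define y' where "y' = ys \<rho>' \<sigma>' x"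
  define z where "z = zs \<rho> \<sigma> x"
  have pos: "0 < \<rho>'" "0 < \<sigma>" using par by auto
  have y': "y' \<in> Y" "norm y' \<le> M" and z: "z \<in> Y" "norm z \<le> M"
    using M x par pos ys_mem zs_mem by (auto simp: uniform_bound_def y'_def z_def)
  have "\<rho> * (f (x, z) - f (x, y')) \<le> M * \<sigma>"
    using M x par pos y' by (auto simp: uniform_bound_def z_def)
  then have "f (x, z) - f (x, y') \<le> M * \<sigma> / \<rho>" using par by (simp add: field_simps)
  then have 1: "(\<rho>' - \<rho>) * (f (x, z) - f (x, y')) \<le> (\<rho>' - \<rho>) * (M * \<sigma> / \<rho>)"
    using par by (intro mult_left_mono) auto
  have "y' \<bullet> z \<le> norm y' * norm z" by (rule norm_cauchy_schwarz)
  also have "\<dots> \<le> M * M" using y' z by (intro mult_mono) (auto intro: order_trans[OF norm_ge_zero])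
  finally have "y' \<bullet> z \<le> M\<^sup>2" by (simp add: power2_eq_square)
  then have "y' \<bullet> z - (norm z)\<^sup>2 / 2 \<le> M\<^sup>2"
    using zero_le_power2[of "norm z"] by linarith
  then have 2: "(\<sigma> - \<sigma>') * (y' \<bullet> z - (norm z)\<^sup>2 / 2) \<le> (\<sigma> - \<sigma>') * M\<^sup>2"
    using par by (intro mult_left_mono) auto
  have "val \<rho>' \<sigma>' x \<le> psi F f \<rho>' \<sigma>' x y' z"
    using val_le_psi[OF x pos(1) par(3) z(1)] by (simp add: y'_def)
  also have "\<dots> = psi F f \<rho> \<sigma> x y' z + (\<rho>' - \<rho>) * (f (x, z) - f (x, y'))
      + (\<sigma> - \<sigma>') * (y' \<bullet> z - (norm z)\<^sup>2 / 2)"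
    unfolding psi_def by (simp add: algebra_simps diff_divide_distrib add_divide_distrib)
  also have "psi F f \<rho> \<sigma> x y' z \<le> val \<rho> \<sigma> x"
    using psi_le_val[OF x par(1) pos(2) y'(1)] by (simp add: z_def)
  finally show ?thesis using 1 2 by linarith
qed

text \<open>The gradient is the search direction at the exact saddle point, so the gradient error of
  an iterate is governed by its saddle point error.\<close>

lemma grad_phi_eq: "grad_phi Y F f \<rho> \<sigma> x = dir_x F f \<rho> x (ys \<rho> \<sigma> x) (zs \<rho> \<sigma> x)"
  by (simp add: grad_phi_def dir_x_def case_prod_beta algebra_simps)

lemma dir_x_diff_le:
  assumes x: "x \<in> X" and mem: "y \<in> Y" "z \<in> Y" "y' \<in> Y" "z' \<in> Y" and \<rho>: "0 \<le> \<rho>"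
  shows "norm (dir_x F f \<rho> x y z - dir_x F f \<rho> x y' z') \<le> L * (1 + 2 * \<rho>) * norm ((y, z) - (y', z'))"
proof -
  define e where "e = norm ((y, z) - (y', z'))"
  have e: "norm (y - y') \<le> e" "norm (z - z') \<le> e"
    using norm_fst_le[of "y - y'" "z - z'"] norm_snd_le[of "z - z'" "y - y'"] by (auto simp: e_def)
  have Le: "L * norm (y - y') \<le> L * e" "L * norm (z - z') \<le> L * e"
    using e L by (auto intro: mult_left_mono)
  let ?a = "grad_x F x y - grad_x F x y'" and ?b = "\<rho> *\<^sub>R (grad_x f x y - grad_x f x y')"
    and ?c = "\<rho> *\<^sub>R (grad_x f x z - grad_x f x z')"
  have "dir_x F f \<rho> x y z - dir_x F f \<rho> x y' z' = ?a - ?b + ?c"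
    by (simp add: dir_x_def algebra_simps)
  then have "norm (dir_x F f \<rho> x y z - dir_x F f \<rho> x y' z') \<le> (norm ?a + norm ?b) + norm ?c"
    by (metis norm_triangle_le add_mono norm_triangle_ineq4 order_refl)
  also have "\<dots> \<le> (L * e + \<rho> * (L * e)) + \<rho> * (L * e)"
    using grad_diff_bounds(1)[OF x x mem(1,3)] grad_diff_bounds(2)[OF x x mem(1,3)]
      grad_diff_bounds(2)[OF x x mem(2,4)] Le \<rho>
    by (intro add_mono) (auto intro!: mult_left_mono)
  also have "\<dots> = L * (1 + 2 * \<rho>) * e" by (simp add: algebra_simps)
  finally show ?thesis by (simp add: e_def)
qed

text \<open>The mixed point is used again, with \<open>y'\<close> from \<open>x'\<close> and
  \<open>z\<close> from \<open>x\<close>. Only \<open>psi\<close> is expanded in \<open>x\<close>;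
  differentiability of \<open>val\<close> does not enter.\<close>

lemma val_descent:
  assumes x: "x \<in> X" "x' \<in> X" and par: "0 < \<rho>" "0 < \<sigma>"
  shows "val \<rho> \<sigma> x' \<le> val \<rho> \<sigma> x + grad_phi Y F f \<rho> \<sigma> x \<bullet> (x' - x)
    + (L * (1 + 2 * \<rho>) + L * (1 + 2 * \<rho>) * (2 * L * (1 + \<rho>) / min \<mu> \<sigma>)) * (norm (x' - x))\<^sup>2"
proof -
  define y y' z d where "y = ys \<rho> \<sigma> x" and "y' = ys \<rho> \<sigma> x'" and "z = zs \<rho> \<sigma> x" and "d = x' - x"
  have mem: "y \<in> Y" "y' \<in> Y" "z \<in> Y" using ys_mem zs_mem x par by (auto simp: y_def y'_def z_def)
  have m: "0 < min \<mu> \<sigma>" using \<mu> par by simp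
  have "norm ((y', z) - (y, z)) \<le> norm (ustar Y F f \<rho> \<sigma> x' - ustar Y F f \<rho> \<sigma> x)"
    unfolding y_def y'_def by (simp add: norm_Pair) (metis fst_diff norm_fst_le prod.collapse)
  also have "\<dots> \<le> 2 * L * (1 + \<rho>) / min \<mu> \<sigma> * norm d"
    using ustar_lipschitz[OF x(2,1) par] m by (simp add: field_simps d_def)
  finally have yy: "norm ((y', z) - (y, z)) \<le> 2 * L * (1 + \<rho>) / min \<mu> \<sigma> * norm d" .
  have quad: "\<bar>F (x', y') - F (x, y') - grad_x F x y' \<bullet> d\<bar> \<le> L * (norm d)\<^sup>2"
    "\<bar>f (x', y') - f (x, y') - grad_x f x y' \<bullet> d\<bar> \<le> L * (norm d)\<^sup>2"
    "\<bar>f (x', z) - f (x, z) - grad_x f x z \<bullet> d\<bar> \<le> L * (norm d)\<^sup>2"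
    using lipschitz_grad_quadratic_bound_x[OF F_diff F_lip X(1) Y(2) x mem(2)]
      lipschitz_grad_quadratic_bound_x[OF f_diff f_lip X(1) Y(2) x mem(2)]
      lipschitz_grad_quadratic_bound_x[OF f_diff f_lip X(1) Y(2) x mem(3)]
    by (auto simp: d_def)
  have q1: "\<rho> * - (L * (norm d)\<^sup>2) \<le> \<rho> * (f (x', y') - f (x, y') - grad_x f x y' \<bullet> d)"
    using quad(2) par by (intro mult_left_mono) auto
  have q2: "\<rho> * (f (x', z) - f (x, z) - grad_x f x z \<bullet> d) \<le> \<rho> * (L * (norm d)\<^sup>2)"
    using quad(3) par by (intro mult_left_mono) auto
  have "psi F f \<rho> \<sigma> x' y' z \<le> psi F f \<rho> \<sigma> x y' z + dir_x F f \<rho> x y' z \<bullet> d + L * (1 + 2 * \<rho>) * (norm d)\<^sup>2"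
    using quad(1) q1 q2 unfolding psi_def dir_x_def
    by (simp add: inner_diff_left algebra_simps abs_le_iff)
  \<comment> \<open>The expansion uses \<open>y'\<close>, the gradient uses \<open>y\<close>.
    Lipschitz dependence of the saddle point on \<open>x\<close> makes the discrepancy of second
    order in \<open>d\<close>.\<close>
  moreover have "(dir_x F f \<rho> x y' z - dir_x F f \<rho> x y z) \<bullet> d
      \<le> L * (1 + 2 * \<rho>) * (2 * L * (1 + \<rho>) / min \<mu> \<sigma>) * (norm d)\<^sup>2"
  proof -
    have "(dir_x F f \<rho> x y' z - dir_x F f \<rho> x y z) \<bullet> d \<le> norm (dir_x F f \<rho> x y' z - dir_x F f \<rho> x y z) * norm d"
      by (rule norm_cauchy_schwarz)
    also have "\<dots> \<le> (L * (1 + 2 * \<rho>) * (2 * L * (1 + \<rho>) / min \<mu> \<sigma> * norm d)) * norm d"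
    proof (rule mult_right_mono[OF order_trans[OF dir_x_diff_le]])
      show "L * (1 + 2 * \<rho>) * norm ((y', z) - (y, z)) \<le> L * (1 + 2 * \<rho>) * (2 * L * (1 + \<rho>) / min \<mu> \<sigma> * norm d)"
        using yy L par by (intro mult_left_mono) auto
    qed (use x mem par in auto)
    finally show ?thesis by (simp add: power2_eq_square mult.assoc)
  qed
  moreover have "val \<rho> \<sigma> x' \<le> psi F f \<rho> \<sigma> x' y' z"
    using val_le_psi[OF x(2) par mem(3)] by (simp add: y'_def)
  moreover have "psi F f \<rho> \<sigma> x y' z \<le> val \<rho> \<sigma> x"
    using psi_le_val[OF x(1) par mem(2)] by (simp add: z_def)
  moreover have "grad_phi Y F f \<rho> \<sigma> x = dir_x F f \<rho> x y z" by (simp add: grad_phi_eq y_def z_def)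
  ultimately show ?thesis unfolding d_def[symmetric] by (simp add: inner_diff_left distrib_right)
qed

end

subsection \<open>One iteration\<close>

lemma young_ineq:
  fixes a b c :: real
  assumes "0 < c"
  shows "a * b \<le> a\<^sup>2 / (4 * c) + c * b\<^sup>2"
proof -
  have "0 \<le> (a - 2 * c * b)\<^sup>2" by simp
  then show ?thesis using assms by (simp add: power2_eq_square field_simps)
qed

lemma norm_add_power2_le:
  fixes a b :: "'a::real_normed_vector"
  assumes "0 < t"
  shows "(norm (a + b))\<^sup>2 \<le> (1 + t) * (norm a)\<^sup>2 + (1 + 1 / t) * (norm b)\<^sup>2"
proof -
  have "(norm (a + b))\<^sup>2 \<le> (norm a + norm b)\<^sup>2" by (intro power_mono norm_triangle_ineq) simp
  also have "\<dots> = (norm a)\<^sup>2 + 2 * (norm a * norm b) + (norm b)\<^sup>2" by (simp add: power2_eq_square algebra_simps)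
  also have "norm b * norm a \<le> (norm b)\<^sup>2 / (4 * (t / 2)) + t / 2 * (norm a)\<^sup>2"
    by (rule young_ineq) (use assms in simp)
  then have "2 * (norm a * norm b) \<le> (norm b)\<^sup>2 / t + t * (norm a)\<^sup>2" by (simp add: field_simps)
  finally show ?thesis by (simp add: algebra_simps)
qed

context bilevel
begin

text \<open>Let \<open>\<delta>\<close> be the length of the outer step and \<open>e\<close> the
  saddle point error. Of the gain \<open>\<delta>\<^sup>2 / \<alpha>\<close>, the inexact direction,
  the curvature of the value and the motion of the saddle point spend a quarter each. Of the
  contraction gain \<open>\<eta> * e\<^sup>2\<close>, the motion spends half and the inexact
  direction a quarter. The conditions \<open>small_\<alpha>\<close> encode these shares, and a
  quarter of both gains is left.\<close>

lemma lyapunov_step: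
  assumes M: "uniform_bound \<tau> M"
    and mem: "x \<in> X" "y \<in> Y" "z \<in> Y"
    and par: "0 < \<rho>" "\<rho> \<le> \<rho>'" "0 < \<sigma>'" "\<sigma>' \<le> \<sigma>" "\<sigma> \<le> \<tau>" "0 < \<alpha>" "0 < \<beta>"
    and m: "m = min \<mu> \<sigma>" and \<eta>: "\<eta> = \<beta> * m" "\<eta> \<le> 1"
    and small_\<beta>: "\<beta> * (2 * (L * (1 + \<rho>) + 2 * \<sigma>))\<^sup>2 \<le> m"
    and C: "C = L * (1 + 2 * \<rho>)" and A: "A = 2 * L * (1 + \<rho>) / m"
    and small_\<alpha>: "\<alpha> * (C + C * A) \<le> 1 / 4" "\<alpha> * C\<^sup>2 \<le> \<eta> / 4" "24 * A\<^sup>2 * \<alpha> \<le> \<eta>"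
    and B: "B = (2 * M * (\<rho>' - \<rho>) + 3 * M * (\<sigma> - \<sigma>')) / m"
    and y': "y' = closest_point Y (y + \<beta> *\<^sub>R dir_y F f \<rho> \<sigma> x y z)"
    and z': "z' = closest_point Y (z - \<beta> *\<^sub>R dir_z f \<rho> \<sigma> x y z)"
    and x': "x' = closest_point X (x - \<alpha> *\<^sub>R dir_x F f \<rho> x y' z')"
  shows "val \<rho>' \<sigma>' x' + (norm ((y', z') - ustar Y F f \<rho>' \<sigma>' x'))\<^sup>2
      \<le> val \<rho> \<sigma> x + (norm ((y, z) - ustar Y F f \<rho> \<sigma> x))\<^sup>2
        - ((norm (x' - x))\<^sup>2 / (4 * \<alpha>) + \<eta> / 4 * (norm ((y, z) - ustar Y F f \<rho> \<sigma> x))\<^sup>2)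
        + (6 * B\<^sup>2 / \<eta> + ((\<rho>' - \<rho>) * (M * \<sigma> / \<rho>) + (\<sigma> - \<sigma>') * M\<^sup>2))" (is ?descent)
    and "\<alpha> * (norm (x - closest_point X (x - \<alpha> *\<^sub>R grad_phi Y F f \<rho> \<sigma> x)) / \<alpha>)\<^sup>2
      \<le> 8 * ((norm (x' - x))\<^sup>2 / (4 * \<alpha>) + \<eta> / 4 * (norm ((y, z) - ustar Y F f \<rho> \<sigma> x))\<^sup>2)" (is ?residual)
proof -
  define u u' us where "u = (y, z)" and "u' = (y', z')" and "us = ustar Y F f \<rho> \<sigma> x"
  define e w \<delta> where "e = norm (u - us)" and "w = norm (u' - us)" and "\<delta> = norm (x' - x)"
  have pos: "0 < \<sigma>" "0 < \<rho>'" "0 < m" "0 < \<eta>" "0 \<le> C" "0 \<le> A"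
    using par \<mu> L by (auto simp: m \<eta> C A)
  have us: "us \<in> Y \<times> Y" using ustar_mem mem par pos by (simp add: us_def)
  have Yne: "Y \<noteq> {}" using mem by auto
  have YY: "convex (Y \<times> Y)" "closed (Y \<times> Y)" "Y \<times> Y \<noteq> {}"
    using Y Yne by (auto intro: convex_Times closed_Times)
  have mem': "y' \<in> Y" "z' \<in> Y" "x' \<in> X"
    using Y X_closed Yne mem by (auto simp: y' z' x' intro!: closest_point_in_set)
  \<comment> \<open>The inner step is one projected step for \<open>saddle_op\<close> that fixes
    \<open>us\<close>, so the contraction applies to \<open>u\<close> and \<open>us\<close>.\<close>
  have "u' = closest_point (Y \<times> Y) (u - \<beta> *\<^sub>R saddle_op \<rho> \<sigma> x u)"
    using closest_point_Times[OF Y(2,1) Yne Y(2,1) Yne]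
    by (simp add: u'_def u_def y' z' saddle_op_def)
  moreover have "us = closest_point (Y \<times> Y) (us - \<beta> *\<^sub>R saddle_op \<rho> \<sigma> x us)"
    using closest_point_fixpoint_iff_variational[OF YY(1,2) us par(7), of "saddle_op \<rho> \<sigma> x us"]
      ustar_variational[OF mem(1) par(1) pos(1), folded us_def]
    by metis
  ultimately have ww: "w\<^sup>2 \<le> (1 - \<eta>) * e\<^sup>2"
    using projected_step_contraction[OF YY, of m u us "saddle_op \<rho> \<sigma> x" "2 * (L * (1 + \<rho>) + 2 * \<sigma>)" \<beta>]
      saddle_op_strongly_monotone[OF mem(1) _ us, of u] saddle_op_lipschitz[OF mem(1) _ us, of u]
      mem par pos small_\<beta>
    by (simp add: w_def e_def \<eta> m u_def)
  have "0 \<le> \<eta> * e\<^sup>2" using pos by simp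
  then have we: "w\<^sup>2 \<le> e\<^sup>2" using ww by (simp add: algebra_simps)
  define d g where "d = dir_x F f \<rho> x y' z'" and "g = grad_phi Y F f \<rho> \<sigma> x"
  have us_mem: "ys \<rho> \<sigma> x \<in> Y" "zs \<rho> \<sigma> x \<in> Y" using us by (auto simp: us_def mem_Times_iff)
  have dg: "norm (d - g) \<le> C * w"
    using dir_x_diff_le[OF mem(1) mem'(1,2) us_mem, of \<rho>] par
    by (simp add: d_def g_def grad_phi_eq C w_def u'_def us_def)

  \<comment> \<open>The projection that defines \<open>x'\<close> is tested with the point
    \<open>x\<close> of \<open>X\<close>.\<close>
  have "\<delta>\<^sup>2 \<le> \<alpha> * (d \<bullet> (x - x'))"
    using closest_point_dot[OF X(1) X_closed mem(1), of "x - \<alpha> *\<^sub>R d"] x'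
    unfolding \<delta>_def d_def[symmetric] power2_norm_eq_inner
    by (simp add: inner_diff_left inner_diff_right inner_commute algebra_simps)
  then have "\<delta>\<^sup>2 / \<alpha> \<le> - (d \<bullet> (x' - x))" using par by (simp add: field_simps inner_diff_right)
  moreover have "(g - d) \<bullet> (x' - x) \<le> \<delta>\<^sup>2 / (4 * \<alpha>) + \<alpha> * (C * w)\<^sup>2"
  proof -
    have "(g - d) \<bullet> (x' - x) \<le> norm (g - d) * \<delta>" unfolding \<delta>_def by (rule norm_cauchy_schwarz)
    also have "\<dots> \<le> \<delta> * (C * w)"
      using mult_right_mono[OF dg, of \<delta>] by (simp add: norm_minus_commute \<delta>_def mult.commute)
    also have "\<dots> \<le> \<delta>\<^sup>2 / (4 * \<alpha>) + \<alpha> * (C * w)\<^sup>2" by (rule young_ineq) (use par in simp)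
    finally show ?thesis .
  qed
  moreover have "\<alpha> * (C * w)\<^sup>2 \<le> \<eta> / 4 * e\<^sup>2"
  proof -
    have "\<alpha> * (C * w)\<^sup>2 = (\<alpha> * C\<^sup>2) * w\<^sup>2" by (simp add: power_mult_distrib)
    also have "\<dots> \<le> \<eta> / 4 * e\<^sup>2" using small_\<alpha>(2) we pos by (intro mult_mono) auto
    finally show ?thesis .
  qed
  moreover have "(C + C * A) * \<delta>\<^sup>2 \<le> \<delta>\<^sup>2 / (4 * \<alpha>)"
  proof -
    have "C + C * A \<le> 1 / (4 * \<alpha>)" using small_\<alpha>(1) par by (simp add: field_simps)
    then have "(C + C * A) * \<delta>\<^sup>2 \<le> 1 / (4 * \<alpha>) * \<delta>\<^sup>2" by (intro mult_right_mono) auto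
    then show ?thesis by simp
  qed
  moreover have "val \<rho> \<sigma> x' \<le> val \<rho> \<sigma> x + g \<bullet> (x' - x) + (C + C * A) * \<delta>\<^sup>2"
    using val_descent[OF mem(1) mem'(3) par(1) pos(1)] by (simp add: g_def \<delta>_def C A m)
  moreover have "g \<bullet> (x' - x) = d \<bullet> (x' - x) + (g - d) \<bullet> (x' - x)" by (simp add: inner_diff_left)
  moreover have "val \<rho>' \<sigma>' x' \<le> val \<rho> \<sigma> x' + ((\<rho>' - \<rho>) * (M * \<sigma> / \<rho>) + (\<sigma> - \<sigma>') * M\<^sup>2)"
    using val_parameter_change[OF M mem'(3) par(1-5)] by simp
  moreover have "\<delta>\<^sup>2 / \<alpha> = 4 * (\<delta>\<^sup>2 / (4 * \<alpha>))" "\<delta>\<^sup>2 / (2 * \<alpha>) = 2 * (\<delta>\<^sup>2 / (4 * \<alpha>))" by simp_all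
  ultimately have val: "val \<rho>' \<sigma>' x' \<le> val \<rho> \<sigma> x - \<delta>\<^sup>2 / (2 * \<alpha>) + \<eta> / 4 * e\<^sup>2
      + ((\<rho>' - \<rho>) * (M * \<sigma> / \<rho>) + (\<sigma> - \<sigma>') * M\<^sup>2)"
    by linarith

  \<comment> \<open>The target moves first from \<open>x\<close> to \<open>x'\<close> at the old
    parameters, then to the new parameters at \<open>x'\<close>.\<close>
  define D where "D = norm (us - ustar Y F f \<rho>' \<sigma>' x')"
  have "D \<le> norm (us - ustar Y F f \<rho> \<sigma> x') + norm (ustar Y F f \<rho> \<sigma> x' - ustar Y F f \<rho>' \<sigma>' x')"
    unfolding D_def by (rule order_trans[OF _ norm_triangle_ineq]) simp
  also have "norm (us - ustar Y F f \<rho> \<sigma> x') \<le> A * \<delta>"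
    using ustar_lipschitz[OF mem(1) mem'(3) par(1) pos(1)] pos
    by (simp add: A m[symmetric] us_def \<delta>_def norm_minus_commute field_simps)
  also have "norm (ustar Y F f \<rho> \<sigma> x' - ustar Y F f \<rho>' \<sigma>' x') \<le> B"
    using ustar_parameter_change[OF M mem'(3) par(1-5)] pos
    by (simp add: B m[symmetric] field_simps)
  finally have "D \<le> A * \<delta> + B" by simp
  then have "D\<^sup>2 \<le> (A * \<delta> + B)\<^sup>2" by (rule power_mono) (simp add: D_def)
  also have "\<dots> \<le> 2 * ((A * \<delta>)\<^sup>2 + B\<^sup>2)"
    using zero_le_power2[of "A * \<delta> - B"] by (simp add: power2_eq_square algebra_simps)
  finally have DD: "D\<^sup>2 \<le> 2 * ((A * \<delta>)\<^sup>2 + B\<^sup>2)" .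

  \<comment> \<open>The split with weight \<open>\<eta> / 2\<close> preserves half of the
    contraction. The other factor is at most \<open>3 / \<eta>\<close> because
    \<open>\<eta> \<le> 1\<close>.\<close>
  have "(norm (u' - ustar Y F f \<rho>' \<sigma>' x'))\<^sup>2 \<le> (1 + \<eta> / 2) * w\<^sup>2 + (1 + 1 / (\<eta> / 2)) * D\<^sup>2"
    using norm_add_power2_le[of "\<eta> / 2" "u' - us" "us - ustar Y F f \<rho>' \<sigma>' x'"] pos
    by (simp add: w_def D_def)
  also have "(1 + \<eta> / 2) * w\<^sup>2 \<le> (1 + \<eta> / 2) * ((1 - \<eta>) * e\<^sup>2)"
    using ww pos by (intro mult_left_mono) auto
  also have "(1 + \<eta> / 2) * ((1 - \<eta>) * e\<^sup>2) = ((1 + \<eta> / 2) * (1 - \<eta>)) * e\<^sup>2" by simp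
  also have "\<dots> \<le> (1 - \<eta> / 2) * e\<^sup>2"
    using pos by (intro mult_right_mono) (auto simp: algebra_simps)
  also have "(1 + 1 / (\<eta> / 2)) * D\<^sup>2 \<le> 3 / \<eta> * (2 * ((A * \<delta>)\<^sup>2 + B\<^sup>2))"
    using DD pos \<eta>(2) by (intro mult_mono) (auto simp: field_simps)
  also have "\<dots> = 6 * A\<^sup>2 / \<eta> * \<delta>\<^sup>2 + 6 * B\<^sup>2 / \<eta>"
    by (simp add: power_mult_distrib add_divide_distrib distrib_left)
  also have "6 * A\<^sup>2 / \<eta> * \<delta>\<^sup>2 \<le> 1 / (4 * \<alpha>) * \<delta>\<^sup>2"
    using small_\<alpha>(3) pos par by (intro mult_right_mono) (auto simp: field_simps)
  finally have "(norm (u' - ustar Y F f \<rho>' \<sigma>' x'))\<^sup>2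
      \<le> (1 - \<eta> / 2) * e\<^sup>2 + (\<delta>\<^sup>2 / (4 * \<alpha>) + 6 * B\<^sup>2 / \<eta>)" by simp
  then show ?descent
    using val unfolding e_def[unfolded u_def us_def, symmetric] \<delta>_def[symmetric] u'_def[symmetric]
    by (simp add: algebra_simps)

  \<comment> \<open>The actual step and the exact gradient step start from the same
    \<open>x\<close>, so by nonexpansiveness they differ by at most
    \<open>\<alpha> * norm (d - g)\<close>.\<close>
  let ?r = "norm (x - closest_point X (x - \<alpha> *\<^sub>R g))"
  have "?r \<le> norm (x - x') + norm (x' - closest_point X (x - \<alpha> *\<^sub>R g))"
    by (rule order_trans[OF _ norm_triangle_ineq]) simp
  also have "norm (x' - closest_point X (x - \<alpha> *\<^sub>R g)) \<le> norm ((x - \<alpha> *\<^sub>R d) - (x - \<alpha> *\<^sub>R g))"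
    using closest_point_lipschitz[OF X(1) X_closed, of "x - \<alpha> *\<^sub>R d" "x - \<alpha> *\<^sub>R g"] mem
    by (auto simp: x' d_def dist_norm)
  also have "\<dots> = \<alpha> * norm (d - g)"
    using par by (metis abs_of_pos diff_diff_eq2 add_diff_cancel_left' diff_add_cancel norm_minus_commute norm_scaleR scaleR_right_diff_distrib)
  also have "\<alpha> * norm (d - g) \<le> \<alpha> * (C * w)" using dg par by simp
  finally have r: "?r \<le> \<delta> + \<alpha> * (C * w)" by (simp add: \<delta>_def norm_minus_commute)
  have "\<alpha> * (?r / \<alpha>)\<^sup>2 = ?r\<^sup>2 / \<alpha>" using par by (simp add: power2_eq_square)
  also have "?r\<^sup>2 \<le> (\<delta> + \<alpha> * (C * w))\<^sup>2" using r by (rule power_mono) simp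
  also have "\<dots> \<le> 2 * \<delta>\<^sup>2 + 2 * (\<alpha> * (C * w))\<^sup>2"
    using zero_le_power2[of "\<delta> - \<alpha> * (C * w)"] by (simp add: power2_eq_square algebra_simps)
  also have "(2 * \<delta>\<^sup>2 + 2 * (\<alpha> * (C * w))\<^sup>2) / \<alpha> = 2 * \<delta>\<^sup>2 / \<alpha> + 2 * (\<alpha> * (C * w)\<^sup>2)"
    using par by (simp add: power2_eq_square field_simps)
  also have "\<dots> \<le> 8 * (\<delta>\<^sup>2 / (4 * \<alpha>) + \<eta> / 4 * e\<^sup>2)"
    using \<open>\<alpha> * (C * w)\<^sup>2 \<le> \<eta> / 4 * e\<^sup>2\<close> \<open>0 \<le> \<eta> * e\<^sup>2\<close> by simp
  finally show ?residual
    using par unfolding e_def[unfolded u_def us_def, symmetric] \<delta>_def[symmetric] g_def[symmetric]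
    by (simp add: divide_right_mono)
qed

end

subsection \<open>Power schedules\<close>

lemma eventually_powr_le:
  fixes a b c d :: real
  assumes "a < b" "0 < d"
  shows "\<forall>\<^sub>F k in sequentially. c * real k powr a \<le> d * real k powr b"
proof -
  have "(\<lambda>k. c * real k powr (a - b)) \<longlonglongrightarrow> c * 0"
    using assms by (intro tendsto_mult tendsto_const tendsto_neg_powr filterlim_real_sequentially) auto
  then have "\<forall>\<^sub>F k in sequentially. c * real k powr (a - b) < d"
    using assms by (intro order_tendstoD(2)) auto
  then show ?thesis
  proof eventually_elim
    case (elim k)
    then have "c * real k powr (a - b) * real k powr b \<le> d * real k powr b"
      by (intro mult_right_mono) auto
    then show ?case by (simp add: mult.assoc powr_add[symmetric])
  qed
qed

text \<open>Mean value theorem; since \<open>e - 1 \<le> 0\<close>, the power in the derivative is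
  largest at the left end point.\<close>

lemma powr_increment_le:
  fixes t e :: real
  assumes "0 < t" "\<bar>e\<bar> \<le> 1"
  shows "\<bar>(t + 1) powr e - t powr e\<bar> \<le> t powr (e - 1)"
proof -
  have "\<exists>\<xi>. t < \<xi> \<and> \<xi> < t + 1 \<and> (t + 1) powr e - t powr e = (t + 1 - t) * (e * \<xi> powr (e - 1))"
    using assms by (intro MVT2) (auto intro!: derivative_eq_intros simp: powr_diff)
  then obtain \<xi> where "t < \<xi>" "(t + 1) powr e - t powr e = e * \<xi> powr (e - 1)" by auto
  moreover have "\<bar>e\<bar> * \<xi> powr (e - 1) \<le> 1 * t powr (e - 1)"
    using assms \<open>t < \<xi>\<close> by (intro mult_mono powr_mono2') auto
  ultimately show ?thesis by (simp add: abs_mult)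
qed

text \<open>The resulting exponent is a premise, so that each use can prescribe its normal
  form.\<close>

lemma powr_combine:
  fixes t :: real
  shows "a + b = c \<Longrightarrow> t powr a * t powr b = t powr c"
    and "a - b = c \<Longrightarrow> t powr a / t powr b = t powr c"
    and "(t powr a)\<^sup>2 = t powr (2 * a)"
  by (auto simp only: powr_add powr_diff power2_eq_square mult_2)

section \<open>Summability along the iterates\<close>

context bilevel
begin

text \<open>The smallness conditions of the one-step estimate hold for large \<open>k\<close>
  because exponents compare strictly, with one exception: both sides of the inner step size
  condition have order k^(-q). It must therefore hold between the constants, and this is where
  \<open>\<beta>\<^sub>0 / \<sigma>\<^sub>0\<close> has to be small.\<close>

lemma sipba_summable:
  assumes pos: "0 < \<alpha>\<^sub>0" "0 < \<beta>\<^sub>0" "0 < \<sigma>\<^sub>0" "0 < \<rho>\<^sub>0"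
    and p: "0 < p" "p < 1" and q: "0 < q" "q < 1" and s: "0 < s" "s < 1 / 2" and pqs: "8 * p + 8 * q \<le> s"
    and \<beta>\<sigma>: "\<beta>\<^sub>0 * (2 * (L + L * \<rho>\<^sub>0 + 2 * \<sigma>\<^sub>0))\<^sup>2 \<le> \<sigma>\<^sub>0"
    and \<alpha>: "\<alpha> = power_schedule \<alpha>\<^sub>0 (- s)" and \<beta>: "\<beta> = power_schedule \<beta>\<^sub>0 (- 2 * p - q)"
    and \<sigma>: "\<sigma> = power_schedule \<sigma>\<^sub>0 (- q)" and \<rho>: "\<rho> = power_schedule \<rho>\<^sub>0 p"
    and it: "SiPBA X Y F f \<alpha> \<beta> \<rho> \<sigma> x y z"
  shows "summable (\<lambda>k. real k powr (- s) * (1 / (\<alpha> k)\<^sup>2 * (norm (x (Suc k) - x k))\<^sup>2))"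
    and "summable (\<lambda>k. real k powr (- (2 * p + 2 * q)) *
      (norm ((y k, z k) - ustar Y F f (\<rho> k) (\<sigma> k) (x k)))\<^sup>2)"
    and "summable (\<lambda>k. real k powr (- s) *
      (norm (x k - closest_point X (x k - \<alpha> k *\<^sub>R grad_phi Y F f (\<rho> k) (\<sigma> k) (x k))) / \<alpha> k)\<^sup>2)"
proof -
  define e where "e = (\<lambda>k. norm ((y k, z k) - ustar Y F f (\<rho> k) (\<sigma> k) (x k)))"
  define \<delta> where "\<delta> = (\<lambda>k. norm (x (Suc k) - x k))"
  define g where "g = (\<lambda>k. norm (x k - closest_point X (x k - \<alpha> k *\<^sub>R grad_phi Y F f (\<rho> k) (\<sigma> k) (x k))) / \<alpha> k)"
  define a where "a = (\<lambda>k. (\<delta> k)\<^sup>2 / (4 * \<alpha> k) + \<beta> k * \<sigma> k / 4 * (e k)\<^sup>2)"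
  define W where "W = (\<lambda>k. val (\<rho> k) (\<sigma> k) (x k) + (e k)\<^sup>2)"
  have sched_pos: "0 < \<alpha> k" "0 < \<beta> k" "0 < \<sigma> k" "0 < \<rho> k" for k
    using pos by (auto simp: \<alpha> \<beta> \<sigma> \<rho> power_schedule_def)
  have sched: "\<alpha> k = \<alpha>\<^sub>0 * real k powr (- s)" "\<beta> k = \<beta>\<^sub>0 * real k powr (- 2 * p - q)"
      "\<sigma> k = \<sigma>\<^sub>0 * real k powr (- q)" "\<rho> k = \<rho>\<^sub>0 * real k powr p" if "1 \<le> k" for k
    using that by (auto simp: \<alpha> \<beta> \<sigma> \<rho> power_schedule_def)
  have \<sigma>_le: "\<sigma> k \<le> \<sigma>\<^sub>0" for k
  proof (cases "k = 0")
    case False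
    then have "real k powr (- q) \<le> real k powr 0" using q by (intro powr_mono) auto
    then show ?thesis using False pos by (simp add: \<sigma> power_schedule_def)
  qed (simp add: \<sigma> power_schedule_def)
  obtain M where M: "0 \<le> M" "uniform_bound \<sigma>\<^sub>0 M" using uniform_bound_exists by blast
  have init: "x 0 \<in> X" "y 0 \<in> Y" "z 0 \<in> Y" using it by (auto simp: SiPBA_def)
  have ne: "X \<noteq> {}" "Y \<noteq> {}" using init by auto
  have steps: "y (Suc k) = closest_point Y (y k + \<beta> k *\<^sub>R dir_y F f (\<rho> k) (\<sigma> k) (x k) (y k) (z k))"
      "z (Suc k) = closest_point Y (z k - \<beta> k *\<^sub>R dir_z f (\<rho> k) (\<sigma> k) (x k) (y k) (z k))"
      "x (Suc k) = closest_point X (x k - \<alpha> k *\<^sub>R dir_x F f (\<rho> k) (x k) (y (Suc k)) (z (Suc k)))" for k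
    using it by (auto simp: SiPBA_def)
  have mem: "x k \<in> X" "y k \<in> Y" "z k \<in> Y" for k
    by (cases k; simp add: init steps closest_point_in_set X_closed Y ne)+

  \<comment> \<open>Prefactors for bounding \<open>C\<close>, \<open>A\<close> and \<open>B\<close>
    of the one-step estimate by \<open>k\<close> to the powers \<open>p\<close>,
    \<open>p + q\<close> and \<open>p + q - 1\<close>.\<close>
  define c1 where "c1 = L * (1 + 2 * \<rho>\<^sub>0)"
  define c2 where "c2 = 2 * L * (1 + \<rho>\<^sub>0) / \<sigma>\<^sub>0"
  define c3 where "c3 = (2 * M * \<rho>\<^sub>0 + 3 * M * \<sigma>\<^sub>0) / \<sigma>\<^sub>0"
  have c: "0 \<le> c1" "0 \<le> c2" "0 \<le> c3" using L M pos by (auto simp: c1_def c2_def c3_def)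
  \<comment> \<open>The first term bounds \<open>6 * B\<^sup>2 / \<eta>\<close>, the second the
    drift of the value. Both exponents lie below -1, the first because
    \<open>4 * p + 4 * q < 1\<close>.\<close>
  define \<epsilon> where "\<epsilon> = (\<lambda>k. 6 * c3\<^sup>2 / (\<beta>\<^sub>0 * \<sigma>\<^sub>0) * real k powr (4 * p + 4 * q - 2)
      + (M * \<sigma>\<^sub>0 + \<sigma>\<^sub>0 * M\<^sup>2) * real k powr (- 1 - q))"

  \<comment> \<open>Constants carry the exponent 0 so that one comparison of powers covers all
    cases. The strictest requirement, \<open>4 * p + 4 * q < s\<close>, follows from
    \<open>8 * p + 8 * q \<le> s\<close>.\<close>
  have ev: "\<forall>\<^sub>F k in sequentially. 1 \<le> k
      \<and> \<sigma>\<^sub>0 * real k powr (- q) \<le> \<mu> * real k powr 0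
      \<and> (\<beta>\<^sub>0 * \<sigma>\<^sub>0) * real k powr (- 2 * p - 2 * q) \<le> 1 * real k powr 0
      \<and> (\<alpha>\<^sub>0 * (c1 + c1 * c2)) * real k powr (2 * p + q - s) \<le> 1 / 4 * real k powr 0
      \<and> (\<alpha>\<^sub>0 * c1\<^sup>2) * real k powr (2 * p - s) \<le> (\<beta>\<^sub>0 * \<sigma>\<^sub>0 / 4) * real k powr (- 2 * p - 2 * q)
      \<and> (24 * c2\<^sup>2 * \<alpha>\<^sub>0) * real k powr (2 * p + 2 * q - s) \<le> (\<beta>\<^sub>0 * \<sigma>\<^sub>0) * real k powr (- 2 * p - 2 * q)"
    by (intro eventually_conj eventually_ge_at_top eventually_powr_le) (use pos p q s pqs \<mu> in auto)
  have main: "\<forall>\<^sub>F k in sequentially. W (Suc k) \<le> W k - a k + \<epsilon> k \<and> \<alpha> k * (g k)\<^sup>2 \<le> 8 * a k"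
    using ev
  proof eventually_elim
    case (elim k)
    define t where "t = real k"
    have t: "1 \<le> t" using elim by (simp add: t_def)
    have k: "1 \<le> k" "1 \<le> Suc k" using elim by auto
    note P = powr_combine[where t = t]
    have eqs: "\<alpha> k = \<alpha>\<^sub>0 * t powr (- s)" "\<beta> k = \<beta>\<^sub>0 * t powr (- 2 * p - q)"
      "\<sigma> k = \<sigma>\<^sub>0 * t powr (- q)" "\<rho> k = \<rho>\<^sub>0 * t powr p"
      "\<sigma> (Suc k) = \<sigma>\<^sub>0 * (t + 1) powr (- q)" "\<rho> (Suc k) = \<rho>\<^sub>0 * (t + 1) powr p"
      using sched[OF k(1)] sched[OF k(2)] by (auto simp: t_def add.commute)
    have small: "\<sigma> k \<le> \<mu>" "\<beta>\<^sub>0 * \<sigma>\<^sub>0 * t powr (- 2 * p - 2 * q) \<le> 1"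
      "\<alpha>\<^sub>0 * (c1 + c1 * c2) * t powr (2 * p + q - s) \<le> 1 / 4"
      "\<alpha>\<^sub>0 * c1\<^sup>2 * t powr (2 * p - s) \<le> \<beta>\<^sub>0 * \<sigma>\<^sub>0 / 4 * t powr (- 2 * p - 2 * q)"
      "24 * c2\<^sup>2 * \<alpha>\<^sub>0 * t powr (2 * p + 2 * q - s) \<le> \<beta>\<^sub>0 * \<sigma>\<^sub>0 * t powr (- 2 * p - 2 * q)"
      using elim t by (auto simp: t_def eqs)
    have tp: "1 \<le> t powr p" "t powr (- q) \<le> t powr p"
      using t p q by (auto intro!: powr_mono ge_one_powr_ge_zero)
    have inc: "\<rho> k \<le> \<rho> (Suc k)" "\<rho> (Suc k) - \<rho> k \<le> \<rho>\<^sub>0 * t powr (p - 1)"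
      "\<sigma> (Suc k) \<le> \<sigma> k" "\<sigma> k - \<sigma> (Suc k) \<le> \<sigma>\<^sub>0 * t powr (- 1 - q)"
    proof -
      have "t powr p \<le> (t + 1) powr p" using t p by (intro powr_mono2) auto
      moreover have "(t + 1) powr (- q) \<le> t powr (- q)" using t q by (intro powr_mono2') auto
      ultimately show "\<rho> k \<le> \<rho> (Suc k)" "\<sigma> (Suc k) \<le> \<sigma> k" using pos by (auto simp: eqs)
      have "\<bar>(t + 1) powr p - t powr p\<bar> \<le> t powr (p - 1)"
        using t p by (intro powr_increment_le) auto
      then have "\<rho>\<^sub>0 * ((t + 1) powr p - t powr p) \<le> \<rho>\<^sub>0 * t powr (p - 1)"
        using pos by (intro mult_left_mono) auto
      then show "\<rho> (Suc k) - \<rho> k \<le> \<rho>\<^sub>0 * t powr (p - 1)" by (simp add: eqs right_diff_distrib)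
      have "\<bar>(t + 1) powr (- q) - t powr (- q)\<bar> \<le> t powr (- q - 1)"
        using t q by (intro powr_increment_le) auto
      also have "- q - 1 = - 1 - q" by simp
      finally have "t powr (- q) - (t + 1) powr (- q) \<le> t powr (- 1 - q)" by linarith
      then have "\<sigma>\<^sub>0 * (t powr (- q) - (t + 1) powr (- q)) \<le> \<sigma>\<^sub>0 * t powr (- 1 - q)"
        using pos by (intro mult_left_mono) auto
      then show "\<sigma> k - \<sigma> (Suc k) \<le> \<sigma>\<^sub>0 * t powr (- 1 - q)" by (simp add: eqs right_diff_distrib)
    qed
    define m \<eta> C A B where "m = \<sigma> k" and "\<eta> = \<beta> k * \<sigma> k" and "C = L * (1 + 2 * \<rho> k)"
      and "A = 2 * L * (1 + \<rho> k) / m"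
      and "B = (2 * M * (\<rho> (Suc k) - \<rho> k) + 3 * M * (\<sigma> k - \<sigma> (Suc k))) / m"
    \<comment> \<open>Eventually \<open>\<sigma> k\<close> is at most \<open>\<mu>\<close>, so it is
      itself the modulus of monotonicity.\<close>
    have m_min: "m = min \<mu> (\<sigma> k)" using small(1) by (simp add: m_def)
    have \<eta>: "\<eta> = \<beta> k * m" by (simp add: \<eta>_def m_def)
    have \<eta>_eq: "\<eta> = \<beta>\<^sub>0 * \<sigma>\<^sub>0 * t powr (- 2 * p - 2 * q)"
    proof -
      have "\<eta> = \<beta>\<^sub>0 * \<sigma>\<^sub>0 * (t powr (- 2 * p - q) * t powr (- q))" by (simp add: \<eta>_def eqs)
      then show ?thesis by (simp add: P(1)[of _ _ "- 2 * p - 2 * q"])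
    qed
    have C_le: "C \<le> c1 * t powr p"
    proof -
      have "C \<le> L * (t powr p + 2 * (\<rho>\<^sub>0 * t powr p))"
        unfolding C_def eqs using tp L by (intro mult_left_mono) auto
      then show ?thesis by (simp add: c1_def algebra_simps)
    qed
    have A_le: "A \<le> c2 * t powr (p + q)"
    proof -
      have "A \<le> 2 * L * (t powr p + \<rho>\<^sub>0 * t powr p) / m"
        unfolding A_def eqs using tp L sched_pos by (intro divide_right_mono mult_left_mono) (auto simp: m_def less_imp_le)
      also have "\<dots> = c2 * (t powr p / t powr (- q))"
        using pos by (simp add: c2_def m_def eqs field_simps)
      finally show ?thesis by (simp add: P(2)[of _ _ "p + q"])
    qed
    have nonneg: "0 \<le> C" "0 \<le> A" using L sched_pos[of k] by (auto simp: C_def A_def m_def)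
    have small_\<beta>: "\<beta> k * (2 * (L * (1 + \<rho> k) + 2 * \<sigma> k))\<^sup>2 \<le> m"
    proof -
      have "L * 1 \<le> L * t powr p" using tp L by (intro mult_left_mono)
      moreover have "\<sigma> k \<le> \<sigma>\<^sub>0 * t powr p" using tp pos by (simp add: eqs)
      ultimately have "2 * (L * (1 + \<rho> k) + 2 * \<sigma> k) \<le> 2 * (L + L * \<rho>\<^sub>0 + 2 * \<sigma>\<^sub>0) * t powr p"
        by (simp add: eqs algebra_simps)
      then have "(2 * (L * (1 + \<rho> k) + 2 * \<sigma> k))\<^sup>2 \<le> (2 * (L + L * \<rho>\<^sub>0 + 2 * \<sigma>\<^sub>0) * t powr p)\<^sup>2"
        using L sched_pos[of k] by (intro power_mono) auto
      then have "\<beta> k * (2 * (L * (1 + \<rho> k) + 2 * \<sigma> k))\<^sup>2 \<le> \<beta> k * (2 * (L + L * \<rho>\<^sub>0 + 2 * \<sigma>\<^sub>0) * t powr p)\<^sup>2"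
        using sched_pos[of k] by simp
      also have "\<dots> = \<beta>\<^sub>0 * (2 * (L + L * \<rho>\<^sub>0 + 2 * \<sigma>\<^sub>0))\<^sup>2 * (t powr (- 2 * p - q) * t powr (2 * p))"
        by (simp only: eqs power_mult_distrib P(3) mult_ac)
      also have "\<dots> = \<beta>\<^sub>0 * (2 * (L + L * \<rho>\<^sub>0 + 2 * \<sigma>\<^sub>0))\<^sup>2 * t powr (- q)" by (simp add: P(1)[of _ _ "- q"])
      also have "\<dots> \<le> \<sigma>\<^sub>0 * t powr (- q)" using \<beta>\<sigma> by (rule mult_right_mono) simp
      finally show ?thesis by (simp add: m_def eqs)
    qed
    have small_\<alpha>1: "\<alpha> k * (C + C * A) \<le> 1 / 4"
    proof -
      have "C * A \<le> (c1 * t powr p) * (c2 * t powr (p + q))"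
        using C_le A_le nonneg c by (intro mult_mono) auto
      also have "\<dots> = c1 * c2 * (t powr p * t powr (p + q))" by simp
      finally have "C * A \<le> c1 * c2 * t powr (2 * p + q)" by (simp add: P(1)[of _ _ "2 * p + q"])
      moreover have "c1 * t powr p \<le> c1 * t powr (2 * p + q)"
        using t p q c by (intro mult_left_mono powr_mono) auto
      ultimately have "C + C * A \<le> (c1 + c1 * c2) * t powr (2 * p + q)"
        using C_le by (simp add: distrib_right)
      then have "\<alpha> k * (C + C * A) \<le> \<alpha> k * ((c1 + c1 * c2) * t powr (2 * p + q))"
        using sched_pos[of k] by simp
      also have "\<dots> = \<alpha>\<^sub>0 * (c1 + c1 * c2) * (t powr (- s) * t powr (2 * p + q))" by (simp add: eqs)
      also have "\<dots> = \<alpha>\<^sub>0 * (c1 + c1 * c2) * t powr (2 * p + q - s)" by (simp add: P(1)[of _ _ "2 * p + q - s"])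
      finally show ?thesis using small(3) by linarith
    qed
    have small_\<alpha>2: "\<alpha> k * C\<^sup>2 \<le> \<eta> / 4"
    proof -
      have "\<alpha> k * C\<^sup>2 \<le> \<alpha> k * (c1 * t powr p)\<^sup>2"
        using C_le nonneg sched_pos[of k] by (intro mult_left_mono power_mono) auto
      also have "\<dots> = \<alpha>\<^sub>0 * c1\<^sup>2 * (t powr (- s) * t powr (2 * p))"
        by (simp only: eqs power_mult_distrib P(3) mult_ac)
      also have "\<dots> = \<alpha>\<^sub>0 * c1\<^sup>2 * t powr (2 * p - s)" by (simp add: P(1)[of _ _ "2 * p - s"])
      finally show ?thesis using small(4) by (simp add: \<eta>_eq)
    qed
    have small_\<alpha>3: "24 * A\<^sup>2 * \<alpha> k \<le> \<eta>"
    proof -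
      have "24 * A\<^sup>2 * \<alpha> k \<le> 24 * (c2 * t powr (p + q))\<^sup>2 * \<alpha> k"
        using A_le nonneg sched_pos[of k] by (intro mult_left_mono mult_right_mono power_mono) auto
      also have "\<dots> = 24 * c2\<^sup>2 * \<alpha>\<^sub>0 * (t powr (- s) * t powr (2 * (p + q)))"
        by (simp only: eqs power_mult_distrib P(3) mult_ac)
      also have "\<dots> = 24 * c2\<^sup>2 * \<alpha>\<^sub>0 * t powr (2 * p + 2 * q - s)" by (simp add: P(1)[of _ _ "2 * p + 2 * q - s"])
      finally show ?thesis using small(5) by (simp add: \<eta>_eq)
    qed
    have drift: "6 * B\<^sup>2 / \<eta> + ((\<rho> (Suc k) - \<rho> k) * (M * \<sigma> k / \<rho> k) + (\<sigma> k - \<sigma> (Suc k)) * M\<^sup>2) \<le> \<epsilon> k"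
    proof -
      \<comment> \<open>The decrement of \<open>\<sigma>\<close> has smaller order than the
        increment of \<open>\<rho>\<close> and is absorbed into the same power.\<close>
      have "t powr (- 1 - q) \<le> t powr (p - 1)" using t p q by (intro powr_mono) auto
      then have "\<sigma>\<^sub>0 * t powr (- 1 - q) \<le> \<sigma>\<^sub>0 * t powr (p - 1)" using pos by simp
      then have "\<sigma> k - \<sigma> (Suc k) \<le> \<sigma>\<^sub>0 * t powr (p - 1)" using inc(4) by linarith
      then have "3 * M * (\<sigma> k - \<sigma> (Suc k)) \<le> 3 * M * (\<sigma>\<^sub>0 * t powr (p - 1))"
        using M by (intro mult_left_mono) auto
      moreover have "2 * M * (\<rho> (Suc k) - \<rho> k) \<le> 2 * M * (\<rho>\<^sub>0 * t powr (p - 1))"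
        using M inc(2) by (intro mult_left_mono) auto
      ultimately have "B \<le> ((2 * M * \<rho>\<^sub>0 + 3 * M * \<sigma>\<^sub>0) * t powr (p - 1)) / m"
        unfolding B_def using sched_pos[of k] by (intro divide_right_mono) (auto simp: m_def algebra_simps)
      also have "\<dots> = c3 * (t powr (p - 1) / t powr (- q))"
        using pos by (simp add: c3_def m_def eqs field_simps)
      also have "\<dots> = c3 * t powr (p + q - 1)" by (simp add: P(2)[of _ _ "p + q - 1"])
      finally have "B \<le> c3 * t powr (p + q - 1)" .
      moreover have "0 \<le> B" using inc M sched_pos[of k] by (auto simp: B_def m_def)
      ultimately have "B\<^sup>2 \<le> (c3 * t powr (p + q - 1))\<^sup>2" by (intro power_mono)
      also have "\<dots> = c3\<^sup>2 * t powr (2 * (p + q - 1))" by (simp only: power_mult_distrib P(3))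
      finally have "6 * B\<^sup>2 / \<eta> \<le> 6 * (c3\<^sup>2 * t powr (2 * (p + q - 1))) / \<eta>"
        using pos t by (intro divide_right_mono mult_left_mono) (auto simp: \<eta>_eq)
      also have "\<dots> = 6 * c3\<^sup>2 / (\<beta>\<^sub>0 * \<sigma>\<^sub>0) * (t powr (2 * (p + q - 1)) / t powr (- 2 * p - 2 * q))"
        by (simp add: \<eta>_eq)
      also have "\<dots> = 6 * c3\<^sup>2 / (\<beta>\<^sub>0 * \<sigma>\<^sub>0) * t powr (4 * p + 4 * q - 2)"
        by (simp add: P(2)[of _ _ "4 * p + 4 * q - 2"])
      finally have 1: "6 * B\<^sup>2 / \<eta> \<le> 6 * c3\<^sup>2 / (\<beta>\<^sub>0 * \<sigma>\<^sub>0) * t powr (4 * p + 4 * q - 2)" .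
      \<comment> \<open>The increments of \<open>\<rho>\<close> alone are not summable; the
        optimality gap of order \<sigma> / \<rho> lowers the exponent to
        \<open>- 1 - q\<close>.\<close>
      have "(\<rho> (Suc k) - \<rho> k) * (M * \<sigma> k / \<rho> k) \<le> (\<rho>\<^sub>0 * t powr (p - 1)) * (M * \<sigma> k / \<rho> k)"
        using inc(2) M sched_pos[of k] by (intro mult_right_mono) auto
      also have "\<dots> = M * \<sigma>\<^sub>0 * (t powr (p - 1) * (t powr (- q) / t powr p))"
        using pos by (simp add: eqs)
      also have "\<dots> = M * \<sigma>\<^sub>0 * t powr (- 1 - q)" by (simp add: P(2)[of _ _ "- q - p"] P(1)[of _ _ "- 1 - q"])
      finally have 2: "(\<rho> (Suc k) - \<rho> k) * (M * \<sigma> k / \<rho> k) \<le> M * \<sigma>\<^sub>0 * t powr (- 1 - q)" .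
      have 3: "(\<sigma> k - \<sigma> (Suc k)) * M\<^sup>2 \<le> (\<sigma>\<^sub>0 * t powr (- 1 - q)) * M\<^sup>2"
        using inc(4) by (intro mult_right_mono) auto
      show ?thesis using 1 2 3 unfolding \<epsilon>_def t_def[symmetric] by (simp add: algebra_simps)
    qed
    have "\<eta> \<le> 1" using small(2) by (simp add: \<eta>_eq)
    note step = lyapunov_step[OF M(2) mem[of k] sched_pos(4)[of k] inc(1) sched_pos(3)[of "Suc k"] inc(3)
        \<sigma>_le sched_pos(1,2)[of k] m_min \<eta> this small_\<beta> C_def A_def small_\<alpha>1 small_\<alpha>2 small_\<alpha>3 B_def]
    from step[OF steps] drift show ?case
      by (simp add: W_def a_def e_def \<delta>_def g_def \<eta>_def)
  qed

  have a_nonneg: "0 \<le> a k" for k using sched_pos[of k] by (simp add: a_def)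
  have sum_a: "summable a"
  proof (rule summable_from_descent)
    show "\<forall>\<^sub>F k in sequentially. W (Suc k) \<le> W k - a k + \<epsilon> k" using main by eventually_elim simp
    show "summable \<epsilon>" unfolding \<epsilon>_def
      by (intro summable_add summable_mult) (use p q s pqs in \<open>simp_all add: summable_real_powr_iff\<close>)
    show "0 \<le> \<epsilon> k" for k using M pos by (simp add: \<epsilon>_def)
    show "\<forall>\<^sub>F k in sequentially. - M \<le> W k"
    proof (rule always_eventually, rule allI)
      fix k
      have "- M \<le> val (\<rho> k) (\<sigma> k) (x k)"
        using M(2) mem sched_pos \<sigma>_le by (simp add: uniform_bound_def)
      then show "- M \<le> W k" by (simp add: W_def add_increasing2)
    qed
  qed (rule a_nonneg)

  \<comment> \<open>The weight is \<open>\<alpha> k / \<alpha>\<^sub>0\<close>, which makes the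
    scaled step a multiple of the first summand of \<open>a\<close>.\<close>
  have "\<forall>\<^sub>F k in sequentially. norm (real k powr (- s) * (1 / (\<alpha> k)\<^sup>2 * (\<delta> k)\<^sup>2)) \<le> 4 / \<alpha>\<^sub>0 * a k"
    using eventually_ge_at_top[of 1]
  proof eventually_elim
    case (elim k)
    have "\<alpha> k = \<alpha>\<^sub>0 * real k powr (- s)" using sched[OF elim] by simp
    then have "real k powr (- s) = \<alpha> k / \<alpha>\<^sub>0" using pos by simp
    then have "norm (real k powr (- s) * (1 / (\<alpha> k)\<^sup>2 * (\<delta> k)\<^sup>2)) = 4 / \<alpha>\<^sub>0 * ((\<delta> k)\<^sup>2 / (4 * \<alpha> k))"
      using pos sched_pos[of k] by (simp add: power2_eq_square)
    also have "\<dots> \<le> 4 / \<alpha>\<^sub>0 * a k"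
      using pos sched_pos[of k] by (intro mult_left_mono) (auto simp: a_def)
    finally show ?case .
  qed
  from summable_comparison_test_ev[OF this summable_mult[OF sum_a]]
  show "summable (\<lambda>k. real k powr (- s) * (1 / (\<alpha> k)\<^sup>2 * (norm (x (Suc k) - x k))\<^sup>2))"
    by (simp add: \<delta>_def)

  \<comment> \<open>Here the weight is a constant multiple of \<open>\<beta> k * \<sigma> k\<close>,
    and the second summand of \<open>a\<close> applies.\<close>
  have "\<forall>\<^sub>F k in sequentially. norm (real k powr (- (2 * p + 2 * q)) * (e k)\<^sup>2) \<le> 4 / (\<beta>\<^sub>0 * \<sigma>\<^sub>0) * a k"
    using eventually_ge_at_top[of 1]
  proof eventually_elim
    case (elim k)
    have "\<beta> k * \<sigma> k = \<beta>\<^sub>0 * \<sigma>\<^sub>0 * (real k powr (- 2 * p - q) * real k powr (- q))"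
      using sched[OF elim] by simp
    also have "\<dots> = \<beta>\<^sub>0 * \<sigma>\<^sub>0 * real k powr (- (2 * p + 2 * q))"
      using elim by (simp add: powr_combine(1)[of _ _ "- (2 * p + 2 * q)"])
    finally have "real k powr (- (2 * p + 2 * q)) * (e k)\<^sup>2 = 4 / (\<beta>\<^sub>0 * \<sigma>\<^sub>0) * (\<beta> k * \<sigma> k / 4 * (e k)\<^sup>2)"
      using pos by simp
    also have "\<dots> \<le> 4 / (\<beta>\<^sub>0 * \<sigma>\<^sub>0) * a k"
      using pos sched_pos[of k] by (intro mult_left_mono) (auto simp: a_def)
    finally show ?case by simp
  qed
  from summable_comparison_test_ev[OF this summable_mult[OF sum_a]]
  show "summable (\<lambda>k. real k powr (- (2 * p + 2 * q)) *
      (norm ((y k, z k) - ustar Y F f (\<rho> k) (\<sigma> k) (x k)))\<^sup>2)"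
    by (simp add: e_def)

  have "\<forall>\<^sub>F k in sequentially. norm (real k powr (- s) * (g k)\<^sup>2) \<le> 8 / \<alpha>\<^sub>0 * a k"
    using eventually_ge_at_top[of 1] main
  proof eventually_elim
    case (elim k)
    have "real k powr (- s) * (g k)\<^sup>2 = 1 / \<alpha>\<^sub>0 * (\<alpha> k * (g k)\<^sup>2)" using sched[OF elim(1)] pos by simp
    also have "\<dots> \<le> 1 / \<alpha>\<^sub>0 * (8 * a k)" using elim(2) pos by (intro mult_left_mono) auto
    finally show ?case by simp
  qed
  from summable_comparison_test_ev[OF this summable_mult[OF sum_a]]
  show "summable (\<lambda>k. real k powr (- s) *
      (norm (x k - closest_point X (x k - \<alpha> k *\<^sub>R grad_phi Y F f (\<rho> k) (\<sigma> k) (x k))) / \<alpha> k)\<^sup>2)"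
    by (simp add: g_def)
qed

end

section \<open>Rates and limits inferior\<close>

theorem theorem4p2:
  fixes X :: "(real ^ 'n) set" and Y :: "(real ^ 'm) set"
    and F f :: "(real ^ 'n) \<times> (real ^ 'm) \<Rightarrow> real"
    and \<alpha>\<^sub>0 \<sigma>\<^sub>0 \<rho>\<^sub>0 s p q :: real
  assumes X: "closed X" "convex X" "compact X"
    and Y: "closed Y" "convex Y"
    and F_C1: "continuously_differentiable F"
    and F_lip: "lipschitz_grad_on (X \<times> Y) F"
    and F_concave: "\<exists>\<mu>>0. \<forall>x\<in>X. strongly_concave_on \<mu> Y (\<lambda>y. F (x, y))"
    and f_C1: "continuously_differentiable f"
    and f_lip: "lipschitz_grad_on (X \<times> Y) f"
    and f_convex: "\<forall>x\<in>X. convex_on Y (\<lambda>y. f (x, y))"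
    and S_nonempty: "\<forall>x\<in>X. argmin_set Y f x \<noteq> {}"
    and S_bounded: "\<forall>B. B \<subseteq> X \<and> bounded B \<longrightarrow>
                      (\<exists>D. bounded D \<and> (\<forall>x\<in>B. argmin_set Y f x \<inter> D \<noteq> {}))"
    and pos: "0 < \<alpha>\<^sub>0" "0 < \<sigma>\<^sub>0" "0 < \<rho>\<^sub>0"
    and s: "0 < s" "s < 1 / 2"
    and p: "0 < p" "p < 1"
    and q: "0 < q" "q < 1"
    and pqs: "8 * p + 8 * q \<le> s"
    and phi_bdd: "bdd_below (phi Y F f ` X)"
  shows "\<exists>c>0. \<forall>\<beta>\<^sub>0>0. \<beta>\<^sub>0 / \<sigma>\<^sub>0 < c \<longrightarrow>
    (let \<alpha> = power_schedule \<alpha>\<^sub>0 (- s);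
         \<beta> = power_schedule \<beta>\<^sub>0 (- 2 * p - q);
         \<sigma> = power_schedule \<sigma>\<^sub>0 (- q);
         \<rho> = power_schedule \<rho>\<^sub>0 p
     in \<forall>x y z. SiPBA X Y F f \<alpha> \<beta> \<rho> \<sigma> x y z \<longrightarrow>
          (\<lambda>K. MIN k\<in>{0<..<K}. 1 / (\<alpha> k)\<^sup>2 * (norm (x (Suc k) - x k))\<^sup>2)
            \<in> O(\<lambda>K. 1 / real K powr (1 - 2 * s)) \<and>
          (\<lambda>K. MIN k\<in>{0<..<K}. (norm ((y k, z k) - ustar Y F f (\<rho> k) (\<sigma> k) (x k)))\<^sup>2)
            \<in> O(\<lambda>K. 1 / real K powr (1 - 6 * p - 7 * q)) \<and>
          liminf (\<lambda>k. ereal (norm (x k - closest_point X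
                    (x k - \<alpha> k *\<^sub>R grad_phi Y F f (\<rho> k) (\<sigma> k) (x k))) / \<alpha> k)) = 0 \<and>
          liminf (\<lambda>k. ereal (norm ((y k, z k) - ustar Y F f (\<rho> k) (\<sigma> k) (x k)))) = 0)"
proof -
  obtain \<mu> where \<mu>: "0 < \<mu>" "\<And>x. x \<in> X \<Longrightarrow> strongly_concave_on \<mu> Y (\<lambda>y. F (x, y))"
    using F_concave by blast
  obtain L1 L2 where "L1-lipschitz_on (X \<times> Y) (grad F)" "L2-lipschitz_on (X \<times> Y) (grad f)"
    using F_lip f_lip by (auto simp: lipschitz_grad_on_def)
  then have lip: "(max L1 L2)-lipschitz_on (X \<times> Y) (grad F)" "(max L1 L2)-lipschitz_on (X \<times> Y) (grad f)"
    by (auto intro: lipschitz_on_le)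
  define L where "L = max L1 L2"
  interpret bilevel X Y F f \<mu> L
    by unfold_locales
      (use assms \<mu> lip compact_imp_bounded[OF X(3)] in \<open>auto simp: L_def\<close>)
  \<comment> \<open>The threshold \<open>1 / N\<close> is the inner step size condition solved for
    \<open>\<beta>\<^sub>0 / \<sigma>\<^sub>0\<close>. It is fixed before
    \<open>\<beta>\<^sub>0\<close> and the iterates are chosen.\<close>
  define N where "N = (2 * (L + L * \<rho>\<^sub>0 + 2 * \<sigma>\<^sub>0))\<^sup>2"
  have "0 < L + L * \<rho>\<^sub>0 + 2 * \<sigma>\<^sub>0" using L pos by (intro add_nonneg_pos) auto
  then have N: "0 < N" by (simp add: N_def)
  show ?thesis
    unfolding Let_def
  proof (intro exI[of _ "1 / N"] conjI allI impI)
    show "0 < 1 / N" using N by simp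
  next
    fix \<beta>\<^sub>0 x y z
    let ?\<alpha> = "power_schedule \<alpha>\<^sub>0 (- s)" and ?\<sigma> = "power_schedule \<sigma>\<^sub>0 (- q)" and ?\<rho> = "power_schedule \<rho>\<^sub>0 p"
    assume \<beta>0: "0 < \<beta>\<^sub>0" "\<beta>\<^sub>0 / \<sigma>\<^sub>0 < 1 / N"
      and it: "SiPBA X Y F f ?\<alpha> (power_schedule \<beta>\<^sub>0 (- 2 * p - q)) ?\<rho> ?\<sigma> x y z"
    have "\<beta>\<^sub>0 * N \<le> \<sigma>\<^sub>0" using \<beta>0 N pos by (simp add: field_simps)
    note sums = sipba_summable[OF pos(1) \<beta>0(1) pos(2,3) p q s pqs this[unfolded N_def] refl refl refl refl it]
    \<comment> \<open>The weight has exponent \<open>s\<close>; the rate is read off with the larger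
      exponent \<open>2 * s\<close>.\<close>
    show "(\<lambda>K. MIN k\<in>{0<..<K}. 1 / (?\<alpha> k)\<^sup>2 * (norm (x (Suc k) - x k))\<^sup>2)
        \<in> O(\<lambda>K. 1 / real K powr (1 - 2 * s))"
      using s by (intro Min_bigo_of_weighted_summable[OF _ sums(1)]) auto
    \<comment> \<open>The weight exponent \<open>2 * p + 2 * q\<close> is at most the rate exponent
      \<open>6 * p + 7 * q\<close>.\<close>
    have "(\<lambda>K. MIN k\<in>{0<..<K}. (norm ((y k, z k) - ustar Y F f (?\<rho> k) (?\<sigma> k) (x k)))\<^sup>2)
        \<in> O(\<lambda>K. 1 / real K powr (1 - (6 * p + 7 * q)))"
      using p q by (intro Min_bigo_of_weighted_summable[OF _ sums(2)]) auto
    then show "(\<lambda>K. MIN k\<in>{0<..<K}. (norm ((y k, z k) - ustar Y F f (?\<rho> k) (?\<sigma> k) (x k)))\<^sup>2)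
        \<in> O(\<lambda>K. 1 / real K powr (1 - 6 * p - 7 * q))"
      by (simp add: diff_diff_eq)
    show "liminf (\<lambda>k. ereal (norm (x k - closest_point X
        (x k - ?\<alpha> k *\<^sub>R grad_phi Y F f (?\<rho> k) (?\<sigma> k) (x k))) / ?\<alpha> k)) = 0"
      using s pos by (intro liminf_zero_of_weighted_summable[OF _ sums(3)]) (auto simp: power_schedule_def)
    \<comment> \<open>The weights have a divergent sum since
      \<open>2 * p + 2 * q \<le> 1\<close>.\<close>
    show "liminf (\<lambda>k. ereal (norm ((y k, z k) - ustar Y F f (?\<rho> k) (?\<sigma> k) (x k)))) = 0"
      using p q s pqs by (intro liminf_zero_of_weighted_summable[OF _ sums(2)]) auto
  qed
qed

end
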